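(* Consider the generalized equation $0\in\Phi x=Fx+Tx$ in the finite-sum setting $F=\frac1n\sum_{i=1}^nF_i$ under the standing assumptions of the context, with $L\rho<1$. Let $\hat L>L$ with $\hat L\rho<1$, $\bar\beta:=\frac{\lambda(4-\hat L\lambda)-4\rho}{4(1-\rho\hat L)}$, $\Lambda:=\frac{\hat L-L}{L\hat L}$, and $$2\rho\le\lambda<\tfrac{2(1+\sqrt{1-\hat L\rho})}{\hat L},\quad 0<\mu<\tfrac23,\quad \nu:=\tfrac\mu2,\quad 0<\beta\le\tfrac{(2-\mu)\bar\beta}{2+\mu},\quad t_k:=\mu(k+r),\quad \eta_k:=\tfrac{2\beta(t_k-1)}{t_k-\nu},\quad r>5+\tfrac1\mu .$$ Let $\{(x^k,z^k)\}$ be generated by the VFOSA$_+$ iteration (see context) where $\widetilde F^k$ is the L-SVRG estimator (see context) with $\tilde x^0=x^0$, $\bar F\tilde x^k:=F\tilde x^k$, and $$b_k:=\lfloor c_bn^{2\omega}\rfloor,\qquad \mathbf p_k:=\begin{cases}\frac{2}{c_pn^\omega}+\frac{4\mu}{\mu(k+r-1)-1}&\text{if }0\le k\le K_0:=\lfloor4c_pn^\omega-r+1+\mu^{-1}\rfloor,\\ \frac{3}{c_pn^\omega}&\text{otherwise,}\end{cases}$$ where $c_p>0$ is a given constant, $\omega\in[0,1]$ is fixed, $n^\omega\ge\frac1{c_p}\max\big\{\frac{2\mu(r-1)-2}{\mu(r-5)-1},\frac{\mu(r-1)-1}{4\mu}\big\}$, and $c_b:=\frac{5\beta c_p^2}{\mu\Lambda}$.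 For $x^\star\in\mathrm{zer}(\Phi)$ let $\Psi_0^2:=\mu^2r^2\,\mathbb{E}[\|G_\lambda x^0\|^2]+\frac{2r-1}{4\beta^2(\mu r-1)}\|x^0-x^\star\|^2$. Then, for a given $\epsilon>0$, the expected total number $\bar{\mathcal T}_K$ of oracle calls $F_i$ and evaluations of $J_{\lambda T}$ to obtain $x^K$ such that $\mathbb{E}[\|G_\lambda x^K\|^2]\le\epsilon^2$ is at most $$\Big\lfloor n+4n\big[2+\ln(4c_pn^\omega)\big]+\frac{\sqrt2\,\Psi_0}{\mu\epsilon}\Big(2c_bn^{2\omega}+\frac{3n^{1-\omega}}{c_p}\Big)\Big\rfloor.$$ In particular, if $\omega:=\frac13$, the oracle complexity is $\bar{\mathcal T}_K=\mathcal O\big(n\ln(n)+\frac{n^{2/3}}{\epsilon}\big)$.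
   Context: Problem: $F_i:\mathbb{R}^p\to\mathbb{R}^p$ ($i=1,\dots,n$) are single-valued, $Fx=\frac1n\sum_{i=1}^nF_ix$, $T:\mathbb{R}^p\rightrightarrows2^{\mathbb{R}^p}$ is possibly multi-valued, $\Phi:=F+T$, $\mathrm{zer}(\Phi):=\{x:0\in\Phi x\}$, $\mathrm{dom}(\Phi)=\{x:\Phi x\neq\emptyset\}$. Standing assumptions. $\mathrm{zer}(\Phi)\neq\emptyset$. $T$ is maximally $\rho$-co-hypomonotone for some $\rho\ge0$: $\langle u-v,x-y\rangle\ge-\rho\|u-v\|^2$ for all $(x,u),(y,v)$ in the graph of $T$, and the graph is not properly contained in that of another such operator. There is $L>0$ with $\langle Fx-Fy,x-y\rangle\ge\frac1{nL}\sum_{i=1}^n\|F_ix-F_iy\|^2$ for all $x,y\in\mathrm{dom}(F)$. Operators: for $\lambda>0$, $J_{\lambda T}x:=\{w:x\in w+\lambda Tw\}$ and $G_\lambda x:=\frac1\lambda\big(x-J_{\lambda T}(x-\lambda Fx)\big)$. VFOSA$_+$ iteration: given $x^0\in\mathrm{dom}(\Phi)$, $z^0:=x^0$, for $k\ge0$: $y^k:=\frac{t_k-1}{t_k}x^k+\frac1{t_k}z^k$; $x^{k+1}:=y^k-\eta_k\widetilde G_\lambda^k$; $z^{k+1}:=z^k+\nu(x^{k+1}-y^k)$, where $\widetilde G_\lambda^k:=\frac1\lambda\big(x^k-J_{\lambda T}(x^k-\lambda\widetilde F^k)\big)$ and $\widetilde F^k$ is a stochastic estimator of $Fx^k$. L-SVRG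 (loopless SVRG) estimator: with a mini-batch $\mathcal S_k$ of size $b_k$ of indices drawn uniformly from $\{1,\dots,n\}$, $\widetilde F^k:=\bar F\tilde x^k+\frac1{b_k}\sum_{i\in\mathcal S_k}(F_ix^k-F_i\tilde x^k)$, where $\tilde x^0:=x^0$ and, for $k\ge1$, $\tilde x^k:=x^{k-1}$ with probability $\mathbf p_k$ and $\tilde x^k:=\tilde x^{k-1}$ with probability $1-\mathbf p_k$; here $\bar F\tilde x^k$ is $F\tilde x^k$ (full-batch evaluation). An oracle call $F_i$ is one evaluation of one component $F_i$ at one point.
   Formalization: The bound is proved separately for the expected number of oracle calls F_i and for the number of evaluations of J_{λT}; for their sum the floor bound can fail (e.g. n=1, F=0, T a scaled rotation). The mini-batch size b_k is assumed to be at least 1. *)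

theory Defs
  imports "HOL-Probability.Probability"
begin

section \<open>Operators\<close>

type_synonym 'a multi_op = "'a \<Rightarrow> 'a set"

definition graph :: "'a multi_op \<Rightarrow> ('a \<times> 'a) set" where
  "graph T = {(x, u). u \<in> T x}"

definition op_dom :: "'a multi_op \<Rightarrow> 'a set" where
  "op_dom \<Phi> = {x. \<Phi> x \<noteq> {}}"

definition zer :: "'a::zero multi_op \<Rightarrow> 'a set" where
  "zer \<Phi> = {x. 0 \<in> \<Phi> x}"

definition cohypomonotone :: "real \<Rightarrow> 'a::real_inner multi_op \<Rightarrow> bool" where
  "cohypomonotone \<rho> T \<longleftrightarrow>
     (\<forall>(x, u) \<in> graph T. \<forall>(y, v) \<in> graph T. inner (u - v) (x - y) \<ge> - \<rho> * (norm (u - v))\<^sup>2)"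

definition maximally_cohypomonotone :: "real \<Rightarrow> 'a::real_inner multi_op \<Rightarrow> bool" where
  "maximally_cohypomonotone \<rho> T \<longleftrightarrow>
     cohypomonotone \<rho> T \<and> (\<nexists>T'. cohypomonotone \<rho> T' \<and> graph T \<subset> graph T')"

definition mean_op :: "nat \<Rightarrow> (nat \<Rightarrow> 'a \<Rightarrow> 'a) \<Rightarrow> 'a \<Rightarrow> 'a::real_vector" where
  "mean_op n F x = (1 / real n) *\<^sub>R (\<Sum>i = 1..n. F i x)"

definition sum_op :: "('a \<Rightarrow> 'a) \<Rightarrow> 'a multi_op \<Rightarrow> 'a::ab_semigroup_add multi_op" where
  "sum_op F T x = {F x + u |u. u \<in> T x}"

definition standing_assumptions ::
    "nat \<Rightarrow> (nat \<Rightarrow> 'a \<Rightarrow> 'a) \<Rightarrow> 'a::euclidean_space multi_op \<Rightarrow> real \<Rightarrow> real \<Rightarrow> bool" where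
  "standing_assumptions n F T \<rho> L \<longleftrightarrow>
     n \<ge> 1 \<and> \<rho> \<ge> 0 \<and> L > 0 \<and>
     zer (sum_op (mean_op n F) T) \<noteq> {} \<and>
     maximally_cohypomonotone \<rho> T \<and>
     (\<forall>x y. inner (mean_op n F x - mean_op n F y) (x - y)
              \<ge> 1 / (real n * L) * (\<Sum>i = 1..n. (norm (F i x - F i y))\<^sup>2))"

definition resolvent_set :: "real \<Rightarrow> 'a multi_op \<Rightarrow> 'a::real_vector multi_op" where
  "resolvent_set lam T x = {w. x \<in> {w + lam *\<^sub>R u |u. u \<in> T w}}"

text \<open>For \<open>T\<close> maximally \<open>\<rho>\<close>-co-hypomonotone and \<open>lam > \<rho>\<close> the set above is a singleton for every
  \<open>x\<close>, so the description below denotes its only element.\<close>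

definition resolvent :: "real \<Rightarrow> 'a multi_op \<Rightarrow> 'a \<Rightarrow> 'a::real_vector" where
  "resolvent lam T x = (THE w. w \<in> resolvent_set lam T x)"

text \<open>The forward-backward residual at \<open>x\<close>, with the vector \<open>v\<close> in place of \<open>F x\<close>.\<close>

definition fb_residual :: "real \<Rightarrow> 'a multi_op \<Rightarrow> 'a \<Rightarrow> 'a \<Rightarrow> 'a::real_vector" where
  "fb_residual lam T v x = (1 / lam) *\<^sub>R (x - resolvent lam T (x - lam *\<^sub>R v))"

definition G_op ::
    "real \<Rightarrow> nat \<Rightarrow> (nat \<Rightarrow> 'a \<Rightarrow> 'a) \<Rightarrow> 'a multi_op \<Rightarrow> 'a \<Rightarrow> 'a::real_vector" where
  "G_op lam n F T x = fb_residual lam T (mean_op n F x) x"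


section \<open>The iteration with the L-SVRG estimator\<close>

text \<open>A mini-batch of size \<open>b\<close> is a tuple of \<open>b\<close> independent uniform indices, that is, sampling
  with replacement, so that every size \<open>b \<ge> 1\<close> is allowed.\<close>

definition batches :: "nat \<Rightarrow> nat \<Rightarrow> nat list set" where
  "batches n b = {S. length S = b \<and> set S \<subseteq> {1..n}}"

definition lsvrg :: "nat \<Rightarrow> (nat \<Rightarrow> 'a \<Rightarrow> 'a) \<Rightarrow> nat list \<Rightarrow> 'a \<Rightarrow> 'a \<Rightarrow> 'a::real_vector" where
  "lsvrg n F S x xt =
     mean_op n F xt + (1 / real (length S)) *\<^sub>R (\<Sum>i\<leftarrow>S. F i x - F i xt)"

text \<open>The state at time \<open>k\<close> holds \<open>x\<^sup>k\<close>, \<open>z\<^sup>k\<close> and the snapshot of the estimator, together with the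
  numbers of evaluations of components of \<open>F\<close> and of the resolvent made so far. The full-batch
  value of \<open>F\<close> at the snapshot is computed when the snapshot is chosen. Hence the count at time
  \<open>K\<close> already contains a possible refresh at time \<open>K\<close>, which \<open>x\<^sup>K\<close> itself does not need.\<close>

datatype 'a vstate =
  VState (cur: 'a) (aux: 'a) (snap: 'a) (F_calls: nat) (J_calls: nat)

definition vfosa_step ::
    "nat \<Rightarrow> (nat \<Rightarrow> 'a \<Rightarrow> 'a) \<Rightarrow> 'a multi_op \<Rightarrow> real \<Rightarrow> real \<Rightarrow> (nat \<Rightarrow> real) \<Rightarrow> (nat \<Rightarrow> real) \<Rightarrow>
     (nat \<Rightarrow> nat) \<Rightarrow> (nat \<Rightarrow> real) \<Rightarrow> nat \<Rightarrow> 'a vstate \<Rightarrow> 'a::real_vector vstate pmf" where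
  "vfosa_step n F T lam \<nu> t \<eta> b p k s = do {
     S \<leftarrow> pmf_of_set (batches n (b k));
     refresh \<leftarrow> bernoulli_pmf (p (k + 1));
     let x = cur s; z = aux s; xt = snap s;
         y = ((t k - 1) / t k) *\<^sub>R x + (1 / t k) *\<^sub>R z;
         G = fb_residual lam T (lsvrg n F S x xt) x;
         x' = y - \<eta> k *\<^sub>R G;
         z' = z + \<nu> *\<^sub>R (x' - y);
         xt' = (if refresh then x else xt)
     in return_pmf (VState x' z' xt'
          (F_calls s + 2 * b k + (if refresh then n else 0)) (J_calls s + 1))
   }"

primrec vfosa ::
    "nat \<Rightarrow> (nat \<Rightarrow> 'a \<Rightarrow> 'a) \<Rightarrow> 'a multi_op \<Rightarrow> real \<Rightarrow> real \<Rightarrow> (nat \<Rightarrow> real) \<Rightarrow> (nat \<Rightarrow> real) \<Rightarrow>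
     (nat \<Rightarrow> nat) \<Rightarrow> (nat \<Rightarrow> real) \<Rightarrow> 'a \<Rightarrow> nat \<Rightarrow> 'a::real_vector vstate pmf" where
  "vfosa n F T lam \<nu> t \<eta> b p x0 0 = return_pmf (VState x0 x0 x0 n 0)"
| "vfosa n F T lam \<nu> t \<eta> b p x0 (Suc k) =
     bind_pmf (vfosa n F T lam \<nu> t \<eta> b p x0 k) (vfosa_step n F T lam \<nu> t \<eta> b p k)"

text \<open>All expectations below are finite sums.\<close>

lemma finite_set_pmf_vfosa:
  assumes "n \<ge> 1"
  shows "finite (set_pmf (vfosa n F T lam \<nu> t \<eta> b p x0 K))"
proof -
  have fin: "finite (batches n m)" for m
    using finite_lists_length_eq[of "{1..n}" m] by (simp add: batches_def conj_commute)
  have "replicate m 1 \<in> batches n m" for m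
    using assms by (auto simp: batches_def)
  then have "set_pmf (pmf_of_set (batches n m)) = batches n m" for m
    using fin by (intro set_pmf_of_set) auto
  then show ?thesis
    by (induction K) (auto simp: vfosa_step_def Let_def fin)
qed


section \<open>Parameters\<close>

definition beta_bar :: "real \<Rightarrow> real \<Rightarrow> real \<Rightarrow> real" where
  "beta_bar \<rho> Lh lam = (lam * (4 - Lh * lam) - 4 * \<rho>) / (4 * (1 - \<rho> * Lh))"

definition Lambda :: "real \<Rightarrow> real \<Rightarrow> real" where
  "Lambda L Lh = (Lh - L) / (L * Lh)"

definition t_seq :: "real \<Rightarrow> real \<Rightarrow> nat \<Rightarrow> real" where
  "t_seq \<mu> r k = \<mu> * (real k + r)"

definition eta_seq :: "real \<Rightarrow> real \<Rightarrow> real \<Rightarrow> nat \<Rightarrow> real" where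
  "eta_seq \<mu> \<beta> r k = 2 * \<beta> * (t_seq \<mu> r k - 1) / (t_seq \<mu> r k - \<mu> / 2)"

definition c_b :: "real \<Rightarrow> real \<Rightarrow> real \<Rightarrow> real \<Rightarrow> real \<Rightarrow> real" where
  "c_b L Lh \<mu> \<beta> c\<^sub>p = 5 * \<beta> * c\<^sub>p\<^sup>2 / (\<mu> * Lambda L Lh)"

definition batch_size :: "real \<Rightarrow> nat \<Rightarrow> real \<Rightarrow> nat" where
  "batch_size cb n \<omega> = nat \<lfloor>cb * real n powr (2 * \<omega>)\<rfloor>"

definition refresh_prob :: "real \<Rightarrow> real \<Rightarrow> real \<Rightarrow> nat \<Rightarrow> real \<Rightarrow> nat \<Rightarrow> real" where
  "refresh_prob \<mu> r c\<^sub>p n \<omega> k =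
     (if int k \<le> \<lfloor>4 * c\<^sub>p * real n powr \<omega> - r + 1 + 1 / \<mu>\<rfloor>
      then 2 / (c\<^sub>p * real n powr \<omega>) + 4 * \<mu> / (\<mu> * (real k + r - 1) - 1)
      else 3 / (c\<^sub>p * real n powr \<omega>))"

text \<open>The lower bound on the number of components makes the refresh probabilities lie in \<open>[0, 1]\<close>.
  The last condition says that the mini-batch is not empty: for small \<open>\<beta>\<close>
  the floor could be \<open>0\<close>, and the estimator divides by the batch size.\<close>

definition admissible_size ::
    "real \<Rightarrow> real \<Rightarrow> real \<Rightarrow> real \<Rightarrow> nat \<Rightarrow> real \<Rightarrow> bool" where
  "admissible_size \<mu> r c\<^sub>p cb n \<omega> \<longleftrightarrow>
     0 \<le> \<omega> \<and> \<omega> \<le> 1 \<and>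
     real n powr \<omega> \<ge> 1 / c\<^sub>p * max ((2 * \<mu> * (r - 1) - 2) / (\<mu> * (r - 5) - 1))
                                ((\<mu> * (r - 1) - 1) / (4 * \<mu>)) \<and>
     batch_size cb n \<omega> \<ge> 1"

definition vfosa_lsvrg ::
    "nat \<Rightarrow> (nat \<Rightarrow> 'a \<Rightarrow> 'a) \<Rightarrow> 'a multi_op \<Rightarrow> real \<Rightarrow> real \<Rightarrow> real \<Rightarrow> real \<Rightarrow> real \<Rightarrow> real \<Rightarrow> real \<Rightarrow>
     'a \<Rightarrow> nat \<Rightarrow> 'a::real_vector vstate pmf" where
  "vfosa_lsvrg n F T lam \<mu> \<beta> r c\<^sub>p cb \<omega> x0 =
     vfosa n F T lam (\<mu> / 2) (t_seq \<mu> r) (eta_seq \<mu> \<beta> r)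
       (\<lambda>k. batch_size cb n \<omega>) (refresh_prob \<mu> r c\<^sub>p n \<omega>) x0"

text \<open>The starting point is deterministic, so the expectation of the squared residual at \<open>x\<^sup>0\<close> is
  its value.\<close>

definition Psi0 ::
    "nat \<Rightarrow> (nat \<Rightarrow> 'a \<Rightarrow> 'a) \<Rightarrow> 'a multi_op \<Rightarrow> real \<Rightarrow> real \<Rightarrow> real \<Rightarrow> real \<Rightarrow>
     'a \<Rightarrow> 'a::real_normed_vector \<Rightarrow> real" where
  "Psi0 n F T lam \<mu> \<beta> r x0 xs =
     sqrt (\<mu>\<^sup>2 * r\<^sup>2 * (norm (G_op lam n F T x0))\<^sup>2
           + (2 * r - 1) / (4 * \<beta>\<^sup>2 * (\<mu> * r - 1)) * (norm (x0 - xs))\<^sup>2)"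

text \<open>Some iterate \<open>x\<^sup>K\<close> of the chain \<open>X\<close> has expected squared residual at most \<open>\<epsilon>\<^sup>2\<close>, and obtaining
  it takes in expectation at most \<open>N\<close> evaluations of components of \<open>F\<close> and at most \<open>N\<close> evaluations
  of the resolvent. The two kinds of evaluations are counted separately: the bounds below account for
  \<open>n\<close> component evaluations per full batch and \<open>2 b\<close> per mini-batch, and have no term for the one
  resolvent evaluation per step.\<close>

definition solves_within :: "(nat \<Rightarrow> 'a vstate pmf) \<Rightarrow> ('a \<Rightarrow> 'a::real_normed_vector) \<Rightarrow> real \<Rightarrow> real \<Rightarrow> bool"
  where
  "solves_within X G \<epsilon> N \<longleftrightarrow>
     (\<exists>K. measure_pmf.expectation (X K) (\<lambda>s. (norm (G (cur s)))\<^sup>2) \<le> \<epsilon>\<^sup>2 \<and>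
          measure_pmf.expectation (X K) (\<lambda>s. real (F_calls s)) \<le> N \<and>
          measure_pmf.expectation (X K) (\<lambda>s. real (J_calls s)) \<le> N)"

end

theory Submission
  imports Defs
begin

text \<open>
  Two facts carry the result. The first is that the forward-backward residual \<open>G\<close> inherits
  co-coercivity from \<open>F\<close> (\<open>G_op_cocoercive\<close>), with a surplus \<open>\<Lambda>\<close> times the mean squared change of the
  components \<open>F\<^sub>i\<close>. This needs the resolvent of \<open>T\<close> to be defined everywhere. For a maximally
  co-hypomonotone operator in a Euclidean space that is Minty's theorem, applied to the maximally
  monotone operator \<open>T\<^sup>-\<^sup>1 + \<rho> I\<close>; here it comes from compactness and a convex minimisation over the
  hull of finitely many points (\<open>monotone_point\<close>).

  The second is a descent property of a quadratic potential along the accelerated iteration. With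
  \<open>\<nu> = \<mu> / 2\<close> and \<open>s = t\<^sub>k - \<mu>\<close> the potential at time \<open>k\<close> is
  \<open>s \<langle>G x, x - z\<rangle> + |z - x\<^sup>\<star>|\<^sup>2 / (2 \<nu> \<eta>\<^sub>k) + \<nu> |x - z|\<^sup>2 / ((1 - \<nu>) \<eta>\<^sub>k) + \<beta> s (s - 1) |G x|\<^sup>2\<close>.
  Without the third term the weight of \<open>|z - x\<^sup>\<star>|\<^sup>2\<close> that makes the inner products
  telescope would be \<open>(1 - \<mu>) / (2 \<nu> \<eta>\<^sub>k)\<close>, and for \<open>\<mu>\<close> near \<open>2 / 3\<close> the form would no longer
  control \<open>|G x|\<^sup>2\<close>. The missing part is supplied by
  \<open>|x - z|\<^sup>2 + (1 / \<nu> - 1) |z - x\<^sup>\<star>|\<^sup>2\<close>, which is itself non-increasing when \<open>F\<close> is exact, and the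
  multiple of it used here raises the weight to exactly the one in \<open>\<Psi>\<^sub>0\<close>.

  The estimator enters through a resolvent, so its error \<open>e\<close> in \<open>G\<close> is biased, and the product of \<open>e\<close>
  with \<open>z - x\<^sup>\<star>\<close> does not average out. It is paid for by the decrease of \<open>1 / \<eta>\<^sub>k\<close>, which is of order
  \<open>1 / t\<^sub>k\<^sup>2\<close> and hence costs a multiple of \<open>t\<^sub>k\<^sup>2 |e|\<^sup>2\<close>, the order of the other leading error terms
  (\<open>potential_step\<close>). The expectation of \<open>|e|\<^sup>2\<close> is at most the mean squared gap between current point and
  snapshot divided by \<open>b\<close>. That gap contracts by \<open>1 - p / 2\<close> and is refilled by \<open>2 / p\<close> times the
  change of the components, which the surplus \<open>\<Lambda>\<close> absorbs. The choice of \<open>p\<^sub>k\<close> matches the growth of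
  \<open>t\<^sub>k\<^sup>2\<close> plus a rate \<open>1 / (c\<^sub>p n\<^sup>\<omega>)\<close>, and the constant in \<open>c\<^sub>b\<close> has a factor two to spare, which
  is needed because rounding down may almost halve the batch.

  The sum of potential and weighted gap is therefore a supermartingale bounded initially by
  \<open>\<beta> \<Psi>\<^sub>0\<^sup>2\<close>, which gives \<open>\<mu>\<^sup>2 (K + r - 1)\<^sup>2 E |G x\<^sup>K|\<^sup>2 \<le> 2 \<Psi>\<^sub>0\<^sup>2\<close>. The smallest \<open>K\<close> with
  \<open>K + r - 1 \<ge> \<surd>2 \<Psi>\<^sub>0 / (\<mu> \<epsilon>)\<close> solves the problem, and the refresh probabilities up to \<open>K\<close> sum to
  at most \<open>3 K / (c\<^sub>p n\<^sup>\<omega>)\<close> plus a logarithm.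
\<close>


section \<open>Resolvents of co-hypomonotone operators\<close>

text \<open>
  Monotonicity of the graph says that \<open>\<langle>a, b'\<rangle> + \<langle>a', b\<rangle> \<le> \<langle>a, b\<rangle> + \<langle>a', b'\<rangle>\<close>. For one fixed pair
  this is an affine condition on the other, hence passes to convex combinations; doing this for
  each pair in turn compares a point of the hull with itself.
\<close>

lemma monotone_hull_inner_le:
  fixes A :: "('a::euclidean_space \<times> 'a) set"
  assumes mono: "\<And>a b a' b'. (a, b) \<in> A \<Longrightarrow> (a', b') \<in> A \<Longrightarrow> inner (a - a') (b - b') \<ge> 0"
    and mem: "(U, X, s) \<in> convex hull ((\<lambda>(a, b). (a, b, inner a b)) ` A)"
  shows "inner U X \<le> s"
proof -
  let ?P = "(\<lambda>(a, b). (a, b, inner a b)) ` A"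
  have halfspace: "convex {(U', X', s'). c + s' - inner U' b - inner a X' \<ge> (0::real)}" for a b :: 'a and c
  proof -
    have "{(U', X', s'). c + s' - inner U' b - inner a X' \<ge> 0} = {p. inner (b, a, -1) p \<le> c}"
      by (auto simp: inner_prod_def inner_commute algebra_simps)
    then show ?thesis by (simp add: convex_halfspace_le)
  qed
  have one: "s' + inner a b - inner U' b - inner a X' \<ge> 0"
    if "(a, b) \<in> A" and "(U', X', s') \<in> convex hull ?P" for a b U' X' s'
  proof -
    have "convex hull ?P \<subseteq> {(U', X', s'). inner a b + s' - inner U' b - inner a X' \<ge> 0}"
      using mono[OF _ that(1)]
      by (intro hull_minimal halfspace) (force simp: algebra_simps inner_commute)
    then show ?thesis using that(2) by (auto simp: algebra_simps)
  qed
  have "convex hull ?P \<subseteq> {(U', X', s'). s + s' - inner U' X - inner U X' \<ge> 0}"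
    using one[OF _ mem] by (intro hull_minimal halfspace) (force simp: algebra_simps)
  then show ?thesis using mem by auto
qed

text \<open>
  The function \<open>\<langle>u - a, u + b\<rangle>\<close> is averaged over convex weights on \<open>A\<close> and minimised over \<open>u\<close>. The
  value is \<open>- H\<close> at the averaged triple, and \<open>H \<ge> 0\<close> by monotonicity. At weights minimising \<open>H\<close>,
  the optimal \<open>u\<close> works for every single pair: this is the saddle point of the game, and the
  first-order condition of the minimisation is the required inequality.
\<close>

lemma monotone_finite_point:
  fixes A :: "('a::euclidean_space \<times> 'a) set"
  assumes mono: "\<And>a b a' b'. (a, b) \<in> A \<Longrightarrow> (a', b') \<in> A \<Longrightarrow> inner (a - a') (b - b') \<ge> 0"
    and fin: "finite A" "A \<noteq> {}"
  shows "\<exists>u. \<forall>(a, b) \<in> A. inner (u - a) (u + b) \<le> 0"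
proof -
  define C where "C = convex hull ((\<lambda>(a, b). (a, b, inner a b)) ` A)"
  define H where "H = (\<lambda>p::'a \<times> 'a \<times> real. (norm (fst p - fst (snd p)))\<^sup>2 / 4 + snd (snd p))"
  have "compact C" "C \<noteq> {}"
    using fin by (auto simp: C_def intro!: finite_imp_compact_convex_hull)
  moreover have "continuous_on C H"
    unfolding H_def by (intro continuous_intros) auto
  ultimately obtain p where p: "p \<in> C" "\<And>q. q \<in> C \<Longrightarrow> H p \<le> H q"
    using continuous_attains_inf by metis
  obtain U X s where pe: "p = (U, X, s)" by (cases p)
  define u where "u = (1/2) *\<^sub>R (U - X)"
  have UX: "U - X = 2 *\<^sub>R u" by (simp add: u_def)
  have le: "inner U X \<le> s"
    using monotone_hull_inner_le[OF mono] p(1) by (simp add: C_def pe)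
  have "(norm (U - X))\<^sup>2 / 4 + inner U X = (norm (U + X))\<^sup>2 / 4"
    by (simp add: power2_norm_eq_inner inner_add_left inner_add_right inner_diff_left
        inner_diff_right inner_commute add_divide_distrib diff_divide_distrib)
  then have H0: "H p \<ge> 0"
    using le zero_le_power2[of "norm (U + X)"] unfolding H_def pe fst_conv snd_conv by linarith
  have "inner (u - a) (u + b) \<le> 0" if "(a, b) \<in> A" for a b
  proof -
    define e where "e = (a - U) - (b - X)"
    define l where "l = inner u e + (inner a b - s)"
    define m where "m = (norm e)\<^sup>2 / 4"
    have "m \<ge> 0" by (simp add: m_def)
    have q: "(a, b, inner a b) \<in> C"
      using that by (auto simp: C_def intro!: hull_inc)
    have "0 \<le> l + h * m" if h: "0 < h" "h \<le> 1" for h :: real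
    proof -
      have "p + h *\<^sub>R ((a, b, inner a b) - p) = (1 - h) *\<^sub>R p + h *\<^sub>R (a, b, inner a b)"
        by (simp add: algebra_simps)
      then have "p + h *\<^sub>R ((a, b, inner a b) - p) \<in> C"
        using p(1) q h convexD[of C p "(a, b, inner a b)" "1 - h" h] by (simp add: C_def)
      from p(2)[OF this] have "H p \<le> H (p + h *\<^sub>R ((a, b, inner a b) - p))" .
      also have "\<dots> = (norm ((U - X) + h *\<^sub>R e))\<^sup>2 / 4 + s + h * (inner a b - s)"
        by (simp add: H_def pe e_def algebra_simps)
      also have "\<dots> = H p + h * (l + h * m)"
      proof -
        have "(norm (2 *\<^sub>R u + h *\<^sub>R e))\<^sup>2 = (norm (2 *\<^sub>R u))\<^sup>2 + 4 * (h * inner u e) + h * (h * (norm e)\<^sup>2)"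
          unfolding power2_norm_eq_inner
          by (simp add: inner_add_left inner_add_right inner_commute[of e u] ring_distribs)
        then show ?thesis
          unfolding UX H_def pe l_def m_def fst_conv snd_conv by (simp add: ring_distribs)
      qed
      finally show ?thesis using h by (simp add: zero_le_mult_iff)
    qed
    then have "\<forall>\<^sub>F h in at_right 0. 0 \<le> l + h * m"
      by (auto simp: eventually_at_right[of 0 1] intro!: exI[of _ 1])
    moreover have "((\<lambda>h. l + h * m) \<longlongrightarrow> l + 0 * m) (at_right 0)"
      by (intro tendsto_intros)
    ultimately have "0 \<le> l"
      using tendsto_lowerbound[of "\<lambda>h. l + h * m" l "at_right 0" 0] by simp
    have X: "X = U - 2 *\<^sub>R u" using UX by (simp add: algebra_simps)
    have "inner (u - a) (u + b) = - l - H p"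
      unfolding l_def e_def H_def pe X
      by (simp add: power2_norm_eq_inner inner_add_left inner_add_right inner_diff_left
          inner_diff_right inner_commute algebra_simps)
    then show ?thesis using \<open>0 \<le> l\<close> H0 by simp
  qed
  then show ?thesis by auto
qed

text \<open>
  Each condition confines \<open>u\<close> to a closed ball with diameter from \<open>a\<close> to \<open>- b\<close>, so the finite
  intersection property of compact sets extends the finite case to all of \<open>A\<close>.
\<close>

lemma monotone_point:
  fixes A :: "('a::euclidean_space \<times> 'a) set"
  assumes mono: "\<And>a b a' b'. (a, b) \<in> A \<Longrightarrow> (a', b') \<in> A \<Longrightarrow> inner (a - a') (b - b') \<ge> 0"
  shows "\<exists>u. \<forall>(a, b) \<in> A. inner (u - a) (u + b) \<le> 0"
proof (cases "A = {}")
  case False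
  define B where "B = (\<lambda>(a, b). {u::'a. inner (u - a) (u + b) \<le> 0})"
  have Beq: "B (a, b) = cball ((1/2) *\<^sub>R (a - b)) (norm (a + b) / 2)" for a b
  proof -
    have "inner (u - a) (u + b) = (norm (u - (1/2) *\<^sub>R (a - b)))\<^sup>2 - (norm (a + b) / 2)\<^sup>2" for u
      unfolding power_divide power2_norm_eq_inner
      by (simp add: inner_add_left inner_add_right inner_diff_left inner_diff_right inner_commute
          algebra_simps) 
    then have "inner (u - a) (u + b) \<le> 0 \<longleftrightarrow> norm (u - (1/2) *\<^sub>R (a - b)) \<le> norm (a + b) / 2" for u
      by (simp add: power_mono_iff)
    then show ?thesis
      unfolding B_def by (simp add: cball_def dist_norm norm_minus_commute[of "(1/2) *\<^sub>R (a - b)"])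
  qed
  obtain a0 where a0: "a0 \<in> A" using False by auto
  have cpt: "compact (B a)" for a by (cases a) (simp add: Beq)
  have "B a0 \<inter> \<Inter>(B ` A) \<noteq> {}"
  proof (rule compact_imp_fip)
    fix F' assume F': "finite F'" "F' \<subseteq> B ` A"
    then obtain A' where A': "finite A'" "A' \<subseteq> A" "F' = B ` A'"
      by (metis finite_subset_image)
    have "\<exists>u. \<forall>(a, b) \<in> insert a0 A'. inner (u - a) (u + b) \<le> 0"
      using A' a0 by (intro monotone_finite_point mono) auto
    then show "B a0 \<inter> \<Inter>F' \<noteq> {}"
      unfolding A' B_def by (auto split: prod.splits) 
  qed (auto simp: cpt compact_imp_closed)
  then show ?thesis by (auto simp: B_def)
qed auto

text \<open>
  A pair related to the whole graph could be added to it.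
\<close>

lemma maximally_cohypomonotoneD:
  assumes "maximally_cohypomonotone \<rho> T"
    and "\<And>y v. v \<in> T y \<Longrightarrow> inner (u - v) (w - y) \<ge> - \<rho> * (norm (u - v))\<^sup>2"
  shows "u \<in> T w"
proof (rule ccontr)
  assume nin: "u \<notin> T w"
  define T' where "T' = T(w := insert u (T w))"
  have mem: "v \<in> T' y \<longleftrightarrow> v \<in> T y \<or> (y = w \<and> v = u)" for v y
    by (auto simp: T'_def)
  have sym: "inner (v - u) (y - w) = inner (u - v) (w - y)" for v y
    by (metis inner_minus_left inner_minus_right minus_diff_eq)
  have co: "cohypomonotone \<rho> T"
    using assms(1) by (simp add: maximally_cohypomonotone_def)
  have "inner (v - v') (y - y') \<ge> - \<rho> * (norm (v - v'))\<^sup>2" if "v \<in> T' y" "v' \<in> T' y'" for v y v' y'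
    using that assms(2)[of v y] assms(2)[of v' y'] co
    unfolding mem by (auto simp: cohypomonotone_def graph_def sym norm_minus_commute[of v u])
  then have "cohypomonotone \<rho> T'"
    by (auto simp: cohypomonotone_def graph_def)
  moreover have "graph T \<subset> graph T'"
    using nin by (auto simp: graph_def mem)
  ultimately show False
    using assms(1) by (auto simp: maximally_cohypomonotone_def)
qed

text \<open>
  Minty's theorem. The pairs \<open>(v, y + \<rho> v)\<close> with \<open>v \<in> T y\<close> form a monotone set; shifted by \<open>x\<close> and scaled by
  \<open>lam - \<rho>\<close> they meet the hypothesis of \<open>monotone_point\<close>, and the point it provides is related to
  the whole graph of \<open>T\<close>.
\<close>

lemma resolvent_set_nonempty:
  fixes T :: "'a::euclidean_space multi_op"
  assumes max: "maximally_cohypomonotone \<rho> T" and lam: "\<rho> < lam"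
  shows "resolvent_set lam T x \<noteq> {}"
proof -
  define c where "c = lam - \<rho>"
  have c: "c > 0" using lam by (simp add: c_def)
  define A where "A = {(v, (1/c) *\<^sub>R (y + \<rho> *\<^sub>R v - x)) | y v. v \<in> T y}"
  have "\<exists>u. \<forall>(a, b) \<in> A. inner (u - a) (u + b) \<le> 0"
  proof (rule monotone_point)
    fix a b a' b' assume "(a, b) \<in> A" "(a', b') \<in> A"
    then obtain y y' where y: "a \<in> T y" "a' \<in> T y'" "b = (1/c) *\<^sub>R (y + \<rho> *\<^sub>R a - x)"
      "b' = (1/c) *\<^sub>R (y' + \<rho> *\<^sub>R a' - x)"
      by (auto simp: A_def)
    have "b - b' = (1/c) *\<^sub>R ((y - y') + \<rho> *\<^sub>R (a - a'))"
      by (simp add: y algebra_simps)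
    then have "inner (a - a') (b - b') = (1/c) * (inner (a - a') (y - y') + \<rho> * (norm (a - a'))\<^sup>2)"
      by (simp only: inner_scaleR_right inner_add_right power2_norm_eq_inner)
    moreover have "inner (a - a') (y - y') \<ge> - \<rho> * (norm (a - a'))\<^sup>2"
      using max y by (auto simp: maximally_cohypomonotone_def cohypomonotone_def graph_def)
    ultimately show "inner (a - a') (b - b') \<ge> 0" using c by simp
  qed
  then obtain u where u: "\<And>v y. v \<in> T y \<Longrightarrow> inner (u - v) (u + (1/c) *\<^sub>R (y + \<rho> *\<^sub>R v - x)) \<le> 0"
    by (auto simp: A_def)
  define w where "w = x - lam *\<^sub>R u"
  have "u \<in> T w"
  proof (rule maximally_cohypomonotoneD[OF max])
    fix y v assume v: "v \<in> T y"
    have "w - y = - (c *\<^sub>R (u + (1/c) *\<^sub>R (y + \<rho> *\<^sub>R v - x))) - \<rho> *\<^sub>R (u - v)"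
      using c by (simp add: w_def scaleR_add_right) (simp add: c_def algebra_simps)
    then have "inner (u - v) (w - y) =
        - c * inner (u - v) (u + (1/c) *\<^sub>R (y + \<rho> *\<^sub>R v - x)) - \<rho> * (norm (u - v))\<^sup>2"
      by (simp only: inner_diff_right inner_minus_right inner_scaleR_right power2_norm_eq_inner)
    then show "inner (u - v) (w - y) \<ge> - \<rho> * (norm (u - v))\<^sup>2"
      using u[OF v] c by (simp add: mult_nonneg_nonpos)
  qed
  then have "w \<in> resolvent_set lam T x"
    by (auto simp: resolvent_set_def w_def)
  then show ?thesis by blast
qed

lemma resolvent_set_unique:
  assumes co: "cohypomonotone \<rho> T" and lam: "\<rho> < lam" "0 < lam"
    and w: "w \<in> resolvent_set lam T x" "w' \<in> resolvent_set lam T x"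
  shows "w = w'"
proof -
  from w obtain u u' where u: "u \<in> T w" "u' \<in> T w'" "x = w + lam *\<^sub>R u" "x = w' + lam *\<^sub>R u'"
    by (auto simp: resolvent_set_def)
  have d: "w - w' = - (lam *\<^sub>R (u - u'))"
    using u(3,4) by (simp add: algebra_simps)
  have "inner (u - u') (w - w') \<ge> - \<rho> * (norm (u - u'))\<^sup>2"
    using co u by (auto simp: cohypomonotone_def graph_def)
  then have "(lam - \<rho>) * (norm (u - u'))\<^sup>2 \<le> 0"
    unfolding d by (simp only: inner_minus_right inner_scaleR_right power2_norm_eq_inner) (simp add: algebra_simps)
  then have "u = u'" using lam by (simp add: mult_le_0_iff)
  then show ?thesis using d by simp
qed

lemma resolvent_inclusion:
  fixes T :: "'a::euclidean_space multi_op"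
  assumes max: "maximally_cohypomonotone \<rho> T" and lam: "\<rho> < lam" "0 < lam"
  obtains u where "u \<in> T (resolvent lam T x)" "x = resolvent lam T x + lam *\<^sub>R u"
proof -
  have "\<exists>!w. w \<in> resolvent_set lam T x"
    using resolvent_set_nonempty[OF max lam(1), of x] max lam
    by (auto simp: maximally_cohypomonotone_def intro: resolvent_set_unique)
  from theI'[OF this] show thesis
    unfolding resolvent_def[symmetric] by (auto simp: resolvent_set_def intro: that)
qed

text \<open>
  Expanding \<open>|d + lam (u - v)|\<^sup>2\<close>, the cross term is at least \<open>- 2 lam \<rho> |u - v|\<^sup>2\<close>, which \<open>lam \<ge> 2 \<rho>\<close>
  lets the last square absorb.
\<close>

lemma resolvent_nonexpansive:
  fixes T :: "'a::euclidean_space multi_op"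
  assumes max: "maximally_cohypomonotone \<rho> T" and lam: "\<rho> < lam" "0 < lam" "2 * \<rho> \<le> lam"
  shows "norm (resolvent lam T x - resolvent lam T y) \<le> norm (x - y)"
proof -
  obtain u where u: "u \<in> T (resolvent lam T x)" "x = resolvent lam T x + lam *\<^sub>R u"
    using resolvent_inclusion[OF max lam(1,2)] .
  obtain v where v: "v \<in> T (resolvent lam T y)" "y = resolvent lam T y + lam *\<^sub>R v"
    using resolvent_inclusion[OF max lam(1,2)] .
  define d where "d = resolvent lam T x - resolvent lam T y"
  have e: "x - y = d + lam *\<^sub>R (u - v)"
    using arg_cong2[OF u(2) v(2), of "(-)"] by (simp add: d_def algebra_simps)
  have sq: "(norm (x - y))\<^sup>2 = (norm d)\<^sup>2 + lam * (2 * inner (u - v) d + lam * (norm (u - v))\<^sup>2)"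
    unfolding e power2_norm_eq_inner
    by (simp add: inner_add_left inner_add_right inner_commute algebra_simps)
  have "inner (u - v) d \<ge> - \<rho> * (norm (u - v))\<^sup>2"
    using max u v unfolding d_def maximally_cohypomonotone_def cohypomonotone_def graph_def by blast
  moreover have "(lam - 2 * \<rho>) * (norm (u - v))\<^sup>2 \<ge> 0" using lam by simp
  ultimately have "lam * (2 * inner (u - v) d + lam * (norm (u - v))\<^sup>2) \<ge> 0"
    using lam(2) by (intro mult_nonneg_nonneg) (auto simp: algebra_simps)
  with sq have "(norm (x - y))\<^sup>2 \<ge> (norm d)\<^sup>2" by simp
  then show ?thesis by (simp add: d_def power2_le_iff_abs_le)
qed


section \<open>The forward-backward residual\<close>

text \<open>
  An error in the estimate of \<open>F x\<close> is not amplified, although the resolvent makes it biased.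
\<close>

lemma fb_residual_error_le:
  fixes T :: "'a::euclidean_space multi_op"
  assumes "maximally_cohypomonotone \<rho> T" "\<rho> < lam" "0 < lam" "2 * \<rho> \<le> lam"
  shows "norm (fb_residual lam T v x - fb_residual lam T v' x) \<le> norm (v - v')"
proof -
  have "fb_residual lam T v x - fb_residual lam T v' x =
      (1 / lam) *\<^sub>R (resolvent lam T (x - lam *\<^sub>R v') - resolvent lam T (x - lam *\<^sub>R v))"
    by (simp add: fb_residual_def algebra_simps)
  then have "norm (fb_residual lam T v x - fb_residual lam T v' x) =
      (1 / lam) * norm (resolvent lam T (x - lam *\<^sub>R v') - resolvent lam T (x - lam *\<^sub>R v))"
    using assms(3) by simp
  also have "\<dots> \<le> (1 / lam) * norm ((x - lam *\<^sub>R v') - (x - lam *\<^sub>R v))"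
    using assms by (intro mult_left_mono resolvent_nonexpansive) auto
  also have "(x - lam *\<^sub>R v') - (x - lam *\<^sub>R v) = lam *\<^sub>R (v - v')"
    by (simp add: algebra_simps)
  finally show ?thesis using assms(3) by simp
qed

lemma G_op_zero:
  fixes T :: "'a::euclidean_space multi_op"
  assumes max: "maximally_cohypomonotone \<rho> T" and lam: "\<rho> < lam" "0 < lam"
    and xs: "xs \<in> zer (sum_op (mean_op n F) T)"
  shows "G_op lam n F T xs = 0"
proof -
  from xs obtain u where u: "u \<in> T xs" "mean_op n F xs + u = 0"
    by (auto simp: zer_def sum_op_def)
  then have "mean_op n F xs = - u" by (simp add: eq_neg_iff_add_eq_0)
  then have "xs \<in> resolvent_set lam T (xs - lam *\<^sub>R mean_op n F xs)"
    using u(1) by (auto simp: resolvent_set_def)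
  moreover have "resolvent lam T y \<in> resolvent_set lam T y" for y
    using resolvent_inclusion[OF max lam, of y] by (auto simp: resolvent_set_def)
  ultimately have "resolvent lam T (xs - lam *\<^sub>R mean_op n F xs) = xs"
    using resolvent_set_unique[of \<rho> T lam] max lam by (auto simp: maximally_cohypomonotone_def)
  then show ?thesis by (simp add: G_op_def fb_residual_def)
qed

lemma norm_mean_power2_le:
  fixes a :: "nat \<Rightarrow> 'a::real_inner"
  shows "(norm ((1 / real n) *\<^sub>R (\<Sum>i = 1..n. a i)))\<^sup>2 \<le> 1 / real n * (\<Sum>i = 1..n. (norm (a i))\<^sup>2)"
proof (cases "n = 0")
  case False
  have "(norm (\<Sum>i = 1..n. a i))\<^sup>2 \<le> (\<Sum>i = 1..n. norm (a i))\<^sup>2"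
    by (intro power_mono norm_sum norm_ge_zero)
  also have "\<dots> \<le> real n * (\<Sum>i = 1..n. (norm (a i))\<^sup>2)"
    using sum_squared_le_sum_of_squares[of "\<lambda>i. norm (a i)" "{1..n}"] by (simp add: mult.commute)
  finally show ?thesis using False
    by (simp add: power_mult_distrib field_simps power2_eq_square)
qed auto

text \<open>
  With \<open>f\<close> and \<open>g\<close> the increments of \<open>F\<close> and of the residual, co-hypomonotonicity of \<open>T\<close> at the two
  resolvent points bounds \<open>\<langle>g, x - y\<rangle>\<close> below by \<open>\<langle>f, x - y\<rangle>\<close> plus a quadratic form in \<open>f\<close> and \<open>g\<close>.
  Splitting \<open>1 / L = \<Lambda> + 1 / Lh\<close> in the co-coercivity of \<open>F\<close> leaves the coefficient
  \<open>1 / Lh - \<rho> > 0\<close> for \<open>|f|\<^sup>2\<close>, and completing the square in \<open>f\<close> produces \<open>beta_bar\<close>.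
\<close>

lemma G_op_cocoercive:
  fixes T :: "'a::euclidean_space multi_op"
  assumes std: "standing_assumptions n F T \<rho> L"
    and lam: "\<rho> < lam" "0 < lam" and Lh: "L < Lh" "Lh * \<rho> < 1"
  shows "inner (G_op lam n F T x - G_op lam n F T y) (x - y) \<ge>
    beta_bar \<rho> Lh lam * (norm (G_op lam n F T x - G_op lam n F T y))\<^sup>2
    + Lambda L Lh * (1 / real n * (\<Sum>i = 1..n. (norm (F i x - F i y))\<^sup>2))"
proof -
  have max: "maximally_cohypomonotone \<rho> T" and L: "L > 0"
    using std by (auto simp: standing_assumptions_def)
  define w where "w = (\<lambda>x. resolvent lam T (x - lam *\<^sub>R mean_op n F x))"
  define f where "f = mean_op n F x - mean_op n F y"
  define g where "g = G_op lam n F T x - G_op lam n F T y"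
  define S where "S = 1 / real n * (\<Sum>i = 1..n. (norm (F i x - F i y))\<^sup>2)"
  have G: "lam *\<^sub>R G_op lam n F T x = x - w x" for x
    using lam by (simp add: G_op_def fb_residual_def w_def)
  have incl: "G_op lam n F T x - mean_op n F x \<in> T (w x)" for x
  proof -
    obtain u where u: "u \<in> T (w x)" "x - lam *\<^sub>R mean_op n F x = w x + lam *\<^sub>R u"
      using resolvent_inclusion[OF max lam] unfolding w_def by metis
    have "lam *\<^sub>R G_op lam n F T x = lam *\<^sub>R (u + mean_op n F x)"
      unfolding G scaleR_add_right using u(2) by (simp add: algebra_simps)
    then have "G_op lam n F T x = u + mean_op n F x" using lam by simp
    then have "u = G_op lam n F T x - mean_op n F x" by simp
    then show ?thesis using u(1) by simp
  qed
  have wd: "w x - w y = (x - y) - lam *\<^sub>R g"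
    unfolding g_def scaleR_diff_right G by simp
  have "inner ((G_op lam n F T x - mean_op n F x) - (G_op lam n F T y - mean_op n F y)) (w x - w y)
     \<ge> - \<rho> * (norm ((G_op lam n F T x - mean_op n F x) - (G_op lam n F T y - mean_op n F y)))\<^sup>2"
    using max incl by (auto simp: maximally_cohypomonotone_def cohypomonotone_def graph_def)
  also have "(G_op lam n F T x - mean_op n F x) - (G_op lam n F T y - mean_op n F y) = g - f"
    by (simp add: g_def f_def)
  finally have 1: "inner g (x - y) \<ge> inner f (x - y) + lam * inner g g - lam * inner f g
      - \<rho> * (inner g g - 2 * inner f g + inner f f)"
    unfolding wd power2_norm_eq_inner
    by (simp add: inner_diff_left inner_diff_right inner_commute[of g f] algebra_simps)
  have "inner f (x - y) \<ge> 1 / L * S"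
    using std by (simp add: standing_assumptions_def f_def S_def mult.commute[of L])
  moreover have "1 / L = Lambda L Lh + 1 / Lh"
    using L Lh by (simp add: Lambda_def field_simps)
  moreover have "1 / Lh * inner f f \<le> 1 / Lh * S"
  proof (rule mult_left_mono)
    have "f = (1 / real n) *\<^sub>R (\<Sum>i = 1..n. F i x - F i y)"
      by (simp add: f_def mean_op_def sum_subtractf algebra_simps)
    then have "(norm f)\<^sup>2 \<le> S"
      using norm_mean_power2_le[of n "\<lambda>i. F i x - F i y"] by (simp only: S_def)
    then show "inner f f \<le> S" by (simp add: power2_norm_eq_inner)
  qed (use L Lh in simp)
  ultimately have 2: "inner f (x - y) \<ge> Lambda L Lh * S + 1 / Lh * inner f f"
    by (simp add: algebra_simps)
  define c where "c = 1 / Lh - \<rho>"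
  have c: "c > 0" using L Lh by (simp add: c_def field_simps)
  have bb: "beta_bar \<rho> Lh lam = (lam - \<rho>) - (lam - 2 * \<rho>)\<^sup>2 / (4 * c)"
  proof -
    have "Lh * c = 1 - \<rho> * Lh" "Lh > 0" using L Lh by (simp_all add: c_def field_simps)
    then have "beta_bar \<rho> Lh lam = (lam * (4 - Lh * lam) - 4 * \<rho>) / (4 * (Lh * c))"
      by (simp add: beta_bar_def)
    also have "lam * (4 - Lh * lam) - 4 * \<rho> = (lam - \<rho>) * (4 * (Lh * c)) - Lh * (lam - 2 * \<rho>)\<^sup>2"
      unfolding \<open>Lh * c = _\<close> by (simp add: algebra_simps power2_eq_square)
    finally show ?thesis using c \<open>Lh > 0\<close> by (simp add: diff_divide_distrib)
  qed
  have "c * inner f f - (lam - 2 * \<rho>) * inner f g \<ge> - ((lam - 2 * \<rho>)\<^sup>2 / (4 * c)) * inner g g"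
  proof -
    have "0 \<le> inner ((2 * c) *\<^sub>R f - (lam - 2 * \<rho>) *\<^sub>R g) ((2 * c) *\<^sub>R f - (lam - 2 * \<rho>) *\<^sub>R g)"
      by simp
    also have "\<dots> = 4 * c * (c * inner f f - (lam - 2 * \<rho>) * inner f g) + (lam - 2 * \<rho>)\<^sup>2 * inner g g"
      by (simp add: inner_diff_left inner_diff_right inner_commute[of g f] algebra_simps power2_eq_square)
    finally show ?thesis using c by (simp add: field_simps)
  qed
  then have "beta_bar \<rho> Lh lam * inner g g \<le>
      (lam - \<rho>) * inner g g + c * inner f f - (lam - 2 * \<rho>) * inner f g"
    unfolding bb left_diff_distrib by linarith
  then have "inner g (x - y) \<ge> beta_bar \<rho> Lh lam * (norm g)\<^sup>2 + Lambda L Lh * S"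
    using 1 2 unfolding power2_norm_eq_inner c_def by (simp add: algebra_simps)
  then show ?thesis unfolding g_def S_def .
qed


section \<open>A potential for the perturbed accelerated step\<close>

lemma young_inner:
  fixes u v :: "'a::real_inner"
  assumes "c > 0"
  shows "inner u v - c * (norm u)\<^sup>2 \<le> (norm v)\<^sup>2 / (4 * c)"
proof -
  have "0 \<le> (norm ((2 * c) *\<^sub>R u - v))\<^sup>2" by simp
  also have "\<dots> = 4 * c * (c * (norm u)\<^sup>2 - inner u v) + (norm v)\<^sup>2"
    unfolding power2_norm_eq_inner
    by (simp add: inner_diff_left inner_diff_right inner_commute[of v u] algebra_simps power2_eq_square)
  finally show ?thesis using assms by (simp add: field_simps)
qed

text \<open>
  The last bound serves \<open>coefficient_GG\<close>: its first summand comes from \<open>|G|\<^sup>2\<close>, its second from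
  Young's inequality for \<open>\<langle>x - z, G\<rangle>\<close>.
\<close>

lemma step_size_bounds:
  fixes \<nu> \<beta> t \<eta> :: real
  assumes \<nu>: "0 < \<nu>" "\<nu> < 1 / 3" and \<beta>: "\<beta> > 0" and t: "t > 1"
    and \<eta>: "\<eta> = 2 * \<beta> * (t - 1) / (t - \<nu>)"
  shows "\<eta> > 0" "\<eta> \<le> 2 * \<beta>" "\<eta> * (1 - \<nu>) \<le> 2 * \<beta> * (t - 1)"
    "\<eta> * (t - \<nu>) = 2 * \<beta> * (t - 1)"
    "\<eta> * t \<le> 2 * \<beta> * t - 2 * \<beta> * (1 - \<nu>)"
    "\<eta> * (1 + (1 - \<nu>) / (2 * t - 1)) \<le> 2 * \<beta>"
proof -
  show 1: "\<eta> > 0" using assms by simp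
  show 4: "\<eta> * (t - \<nu>) = 2 * \<beta> * (t - 1)" using assms by simp
  have "\<eta> * (1 - \<nu>) \<le> \<eta> * (t - \<nu>)" using 1 t by (intro mult_left_mono) auto
  then show "\<eta> * (1 - \<nu>) \<le> 2 * \<beta> * (t - 1)" using 4 by simp
  have "2 * \<beta> * (t - 1) \<le> 2 * \<beta> * (t - \<nu>)" using assms by (intro mult_left_mono) auto
  then show 2: "\<eta> \<le> 2 * \<beta>" using assms by (simp add: pos_divide_le_eq)
  have "\<eta> * t = 2 * \<beta> * (t - 1) + \<eta> * \<nu>" using 4 by (simp add: algebra_simps)
  also have "\<dots> \<le> 2 * \<beta> * (t - 1) + 2 * \<beta> * \<nu>" using 2 \<nu> by simp
  finally show "\<eta> * t \<le> 2 * \<beta> * t - 2 * \<beta> * (1 - \<nu>)" by (simp add: algebra_simps)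
  have "(t - 1) * (2 * t - \<nu>) \<le> (t - \<nu>) * (2 * t - 1)"
    using assms by (simp add: algebra_simps)
  then have "2 * \<beta> * ((t - 1) * (2 * t - \<nu>)) \<le> 2 * \<beta> * ((t - \<nu>) * (2 * t - 1))"
    using \<beta> by simp
  moreover have "1 + (1 - \<nu>) / (2 * t - 1) = (2 * t - \<nu>) / (2 * t - 1)"
    using t by (simp add: field_simps)
  ultimately show "\<eta> * (1 + (1 - \<nu>) / (2 * t - 1)) \<le> 2 * \<beta>"
    using t \<nu> by (simp add: \<eta> divide_le_eq mult.assoc)
qed

text \<open>
  The coefficient of \<open>|G x\<^sup>k|\<^sup>2\<close> collected in \<open>potential_step\<close>. The terms growing with \<open>t\<close> combine to
  \<open>- \<beta> (2 - 3 \<mu>) (t - 1)\<close>, which is where \<open>\<mu> < 2 / 3\<close> is needed. The rest is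
  \<open>\<beta> (5 \<nu> - 6 \<nu>\<^sup>2) - B\<close>, negative uniformly in \<open>\<nu> < 1 / 3\<close> by the upper bound on \<open>\<beta>\<close>. Since the growing
  part vanishes as \<open>\<mu>\<close> tends to \<open>2 / 3\<close>, only the constant \<open>\<beta> / 2\<close> is kept.
\<close>

lemma coefficient_GG:
  fixes \<nu> \<beta> t \<eta> B :: real
  assumes \<nu>: "0 < \<nu>" "\<nu> < 1 / 3" and \<beta>: "\<beta> > 0" and t: "t > 1"
    and \<eta>: "\<eta> = 2 * \<beta> * (t - 1) / (t - \<nu>)" and B: "\<beta> * ((1 + \<nu>) / (1 - \<nu>)) \<le> B"
  shows "\<eta> * t * (t - 1) - \<beta> * t * (t - 1) - \<beta> * (t - 2 * \<nu>) * (t - 2 * \<nu> - 1) - B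
     + \<nu> * \<eta> * (3 / 2 - \<nu>) + \<nu> * (1 - \<nu>) * \<eta> / (2 * t - 1) \<le> - (\<beta> / 2)"
proof -
  note b = step_size_bounds[OF \<nu> \<beta> t \<eta>]
  have "\<eta> * t * (t - 1) \<le> (2 * \<beta> * t - 2 * \<beta> * (1 - \<nu>)) * (t - 1)"
    using b(5) t by (intro mult_right_mono) auto
  also have "\<dots> = \<beta> * t * (t - 1) + \<beta> * (t - 2 * \<nu>) * (t - 2 * \<nu> - 1)
      - \<beta> * (2 - 6 * \<nu>) * (t - 1) + \<beta> * (2 * \<nu> - 4 * \<nu>\<^sup>2)"
    by (simp add: algebra_simps power2_eq_square)
  also have "\<dots> \<le> \<beta> * t * (t - 1) + \<beta> * (t - 2 * \<nu>) * (t - 2 * \<nu> - 1) + \<beta> * (2 * \<nu> - 4 * \<nu>\<^sup>2)"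
    using \<nu> \<beta> t by simp
  finally have 1: "\<eta> * t * (t - 1) - \<beta> * t * (t - 1) - \<beta> * (t - 2 * \<nu>) * (t - 2 * \<nu> - 1)
      \<le> \<beta> * (2 * \<nu> - 4 * \<nu>\<^sup>2)" by simp
  have "\<nu> * \<eta> * (3 / 2 - \<nu>) + \<nu> * (1 - \<nu>) * \<eta> / (2 * t - 1)
      = \<nu> * (1 / 2 - \<nu>) * \<eta> + \<nu> * (\<eta> * (1 + (1 - \<nu>) / (2 * t - 1)))"
    by (simp add: algebra_simps)
  also have "\<dots> \<le> \<nu> * (1 / 2 - \<nu>) * (2 * \<beta>) + \<nu> * (2 * \<beta>)"
    using b(2,6) \<nu> by (intro add_mono mult_left_mono) auto
  also have "\<dots> = \<beta> * (3 * \<nu> - 2 * \<nu>\<^sup>2)" by (simp add: algebra_simps power2_eq_square)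
  finally have 2: "\<nu> * \<eta> * (3 / 2 - \<nu>) + \<nu> * (1 - \<nu>) * \<eta> / (2 * t - 1) \<le> \<beta> * (3 * \<nu> - 2 * \<nu>\<^sup>2)" .
  \<comment> \<open>The cubic is the numerator of \<open>(1 + \<nu>) / (1 - \<nu>) - (5 \<nu> - 6 \<nu>\<^sup>2 + 1 / 2)\<close>.\<close>
  have "0 \<le> 1 / 2 - 7 / 2 * \<nu> + 11 * \<nu>\<^sup>2 - 6 * \<nu> ^ 3"
  proof -
    have "1 / 2 - 7 / 2 * \<nu> + 11 * \<nu>\<^sup>2 - 6 * \<nu> ^ 3 = 9 * (\<nu> - 7 / 36)\<^sup>2 + \<nu>\<^sup>2 * (2 - 6 * \<nu>) + (1/2 - 49 / 144)"
      by (simp add: algebra_simps power2_eq_square power3_eq_cube)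
    moreover have "\<nu>\<^sup>2 * (2 - 6 * \<nu>) \<ge> 0" using \<nu> by simp
    moreover have "9 * (\<nu> - 7 / 36)\<^sup>2 \<ge> 0" by simp
    ultimately show ?thesis by linarith
  qed
  moreover have "(5 * \<nu> - 6 * \<nu>\<^sup>2 + 1 / 2) * (1 - \<nu>) = 1 / 2 + 9 / 2 * \<nu> - 11 * \<nu>\<^sup>2 + 6 * \<nu> ^ 3"
    by (simp add: field_simps power2_eq_square power3_eq_cube)
  ultimately have "(5 * \<nu> - 6 * \<nu>\<^sup>2 + 1 / 2) * (1 - \<nu>) \<le> 1 + \<nu>"
    by linarith
  then have "5 * \<nu> - 6 * \<nu>\<^sup>2 + 1 / 2 \<le> (1 + \<nu>) / (1 - \<nu>)"
    using \<nu> by (simp add: pos_le_divide_eq)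
  then have "\<beta> * (5 * \<nu> - 6 * \<nu>\<^sup>2 + 1 / 2) \<le> \<beta> * ((1 + \<nu>) / (1 - \<nu>))"
    using \<beta> by (intro mult_left_mono) auto
  then have "\<beta> * (5 * \<nu> - 6 * \<nu>\<^sup>2 + 1 / 2) \<le> B" using B by linarith
  then show ?thesis using 1 2 by (simp add: algebra_simps)
qed

text \<open>
  The coefficient of \<open>\<langle>G x\<^sup>k, e\<rangle>\<close>. Its two products with \<open>t (t - 1)\<close> nearly cancel, so that it is only of order
  \<open>t\<close> and can be balanced against the constant multiple of \<open>|G x\<^sup>k|\<^sup>2\<close> left by \<open>coefficient_GG\<close>.
\<close>

lemma coefficient_Ge:
  fixes \<nu> \<beta> t \<eta> :: real
  assumes \<nu>: "0 < \<nu>" "\<nu> < 1 / 3" and \<beta>: "\<beta> > 0" and t: "t > 1"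
    and \<eta>: "\<eta> = 2 * \<beta> * (t - 1) / (t - \<nu>)"
  shows "\<bar>(\<eta> - 2 * \<beta>) * t * (t - 1) - \<nu> * \<eta> + 2 * \<nu> * \<eta> * (3 / 2 - \<nu>)
     - 2 * (\<nu> * (1 - \<nu>) * \<eta> / (2 * t - 1)) * (t - 1)\<bar> \<le> 2 * \<beta> * (t - 1)" (is "\<bar>?m\<bar> \<le> _")
proof -
  note b = step_size_bounds[OF \<nu> \<beta> t \<eta>]
  have "(\<eta> - 2 * \<beta>) * (t - 1) = - (1 - \<nu>) * \<eta>"
    using b(4) by (simp add: algebra_simps)
  then have "(\<eta> - 2 * \<beta>) * t * (t - 1) = - (1 - \<nu>) * \<eta> * t"
    by (simp add: mult.assoc mult.commute mult.left_commute) 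
  moreover have "2 * (\<nu> * (1 - \<nu>) * \<eta> / (2 * t - 1)) * (t - 1) =
      \<nu> * (1 - \<nu>) * \<eta> - \<nu> * (1 - \<nu>) * \<eta> / (2 * t - 1)"
    using t by (simp add: field_simps)
  ultimately have "?m = - (1 - \<nu>) * \<eta> * (t - \<nu>) + (1 - \<nu>) * \<eta> * (\<nu> / (2 * t - 1))"
    by (simp add: algebra_simps)
  also have "\<dots> = (1 - \<nu>) * (\<eta> * (\<nu> / (2 * t - 1)) - \<eta> * (t - \<nu>))"
    by (simp add: algebra_simps)
  also have "\<dots> = (1 - \<nu>) * (\<eta> * (\<nu> / (2 * t - 1)) - 2 * \<beta> * (t - 1))"
    unfolding b(4) ..
  finally have m: "?m = (1 - \<nu>) * (\<eta> * (\<nu> / (2 * t - 1)) - 2 * \<beta> * (t - 1))" .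
  have "\<nu> / (2 * t - 1) \<le> 1 - \<nu>"
  proof -
    have "\<nu> \<le> (1 - \<nu>) * 1" using \<nu> by simp
    also have "\<dots> \<le> (1 - \<nu>) * (2 * t - 1)" using \<nu> t by (intro mult_left_mono) auto
    finally show ?thesis using t by (simp add: pos_divide_le_eq)
  qed
  then have "\<eta> * (\<nu> / (2 * t - 1)) \<le> \<eta> * (1 - \<nu>)" using b(1) by (intro mult_left_mono) auto
  then have "\<eta> * (\<nu> / (2 * t - 1)) \<le> 2 * \<beta> * (t - 1)" using b(3) by linarith
  moreover have "\<eta> * (\<nu> / (2 * t - 1)) \<ge> 0" using b(1) \<nu> t by simp
  ultimately have "\<bar>\<eta> * (\<nu> / (2 * t - 1)) - 2 * \<beta> * (t - 1)\<bar> \<le> 2 * \<beta> * (t - 1)"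
    by linarith
  then have "(1 - \<nu>) * \<bar>\<eta> * (\<nu> / (2 * t - 1)) - 2 * \<beta> * (t - 1)\<bar> \<le> 1 * (2 * \<beta> * (t - 1))"
    using \<nu> by (intro mult_mono) auto
  then show ?thesis using \<nu> unfolding m by (simp add: abs_mult)
qed

text \<open>
  All contributions to \<open>|e|\<^sup>2\<close>. The dominant one, of size \<open>\<beta> / (2 \<nu>)\<close> times \<open>t (t - 1)\<close>, comes from
  \<open>\<langle>G' - G, e\<rangle>\<close>. The constant \<open>7 / 4\<close> is small enough for the batch size to absorb it even after
  rounding down.
\<close>

lemma coefficient_ee:
  fixes \<nu> \<beta> t \<eta> :: real
  assumes \<nu>: "0 < \<nu>" "\<nu> < 1 / 3" and \<beta>: "\<beta> > 0" and t: "t > 1"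
    and \<eta>: "\<eta> = 2 * \<beta> * (t - 1) / (t - \<nu>)"
  shows "\<nu> * \<eta> * (1 / 2 - \<nu>) + \<nu> * (1 - \<nu>) * \<eta> / (2 * t - 1) * (t - 1)\<^sup>2
     + \<beta> * (t - 1) * (t - 1 + 2 * \<nu>) / (2 * (1 - \<nu>)) + \<beta> * t * (t - 1) * (1 - \<nu>) / (2 * \<nu>)
     + 2 * \<beta> * (t - 1)\<^sup>2 \<le> 7 * \<beta> / (4 * \<nu>) * (t * (t - 1))"
proof -
  note b = step_size_bounds[OF \<nu> \<beta> t \<eta>]
  define M where "M = \<beta> * (t * (t - 1))"
  have M: "M \<ge> 0" and M1: "\<beta> * (t - 1) \<le> M"
    using \<beta> t by (auto simp: M_def)
  have "\<eta> * (1 / 2 - \<nu>) \<le> \<eta> * ((1 - \<nu>) / 2)" using b(1) \<nu> by (intro mult_left_mono) auto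
  then have "\<eta> * (1 / 2 - \<nu>) \<le> \<beta> * (t - 1)" using b(3) by simp
  then have "\<nu> * (\<eta> * (1 / 2 - \<nu>)) \<le> \<nu> * M" using M1 \<nu> by (intro mult_left_mono) auto
  then have 1: "\<nu> * \<eta> * (1 / 2 - \<nu>) \<le> \<nu> * M" by (simp add: mult.assoc)
  have "(1 - \<nu>) * \<eta> \<le> 1 * (2 * \<beta>)" using b(1,2) \<nu> by (intro mult_mono) auto
  moreover have "(t - 1)\<^sup>2 / (2 * t - 1) \<le> (t - 1) / 2"
    using t by (simp add: divide_simps power2_eq_square)
  ultimately have "(1 - \<nu>) * \<eta> * ((t - 1)\<^sup>2 / (2 * t - 1)) \<le> 1 * (2 * \<beta>) * ((t - 1) / 2)"
    by (rule mult_mono) (use b(1) \<nu> \<beta> t in auto)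
  then have "\<nu> * ((1 - \<nu>) * \<eta> * ((t - 1)\<^sup>2 / (2 * t - 1))) \<le> \<nu> * M"
    using \<nu> M1 by (intro mult_left_mono) auto
  then have 2: "\<nu> * (1 - \<nu>) * \<eta> / (2 * t - 1) * (t - 1)\<^sup>2 \<le> \<nu> * M" by (simp add: mult.assoc)
  have "\<beta> * (t - 1) * (t - 1 + 2 * \<nu>) / (2 * (1 - \<nu>)) \<le> \<beta> * (t - 1) * t / (4 / 3)"
    using \<nu> \<beta> t by (intro frac_le mult_left_mono) auto
  then have 3: "\<beta> * (t - 1) * (t - 1 + 2 * \<nu>) / (2 * (1 - \<nu>)) \<le> 3 / 4 * M"
    by (simp add: M_def mult.assoc mult.commute mult.left_commute)
  have 4: "\<beta> * t * (t - 1) * (1 - \<nu>) / (2 * \<nu>) = M / (2 * \<nu>) - M / 2"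
    using \<nu> by (simp add: M_def field_simps)
  have "(t - 1) * (t - 1) \<le> t * (t - 1)" using t by (intro mult_right_mono) auto
  then have 5: "2 * \<beta> * (t - 1)\<^sup>2 \<le> 2 * M" using \<beta> by (simp add: M_def power2_eq_square)
  have "8 * \<nu>\<^sup>2 + 9 * \<nu> + 2 \<le> 7"
  proof -
    have "\<nu>\<^sup>2 \<le> \<nu> * (1 / 3)" unfolding power2_eq_square using \<nu> by (intro mult_left_mono) auto
    then show ?thesis using \<nu> by linarith
  qed
  then have "(8 * \<nu>\<^sup>2 + 9 * \<nu> + 2) / (4 * \<nu>) \<le> 7 / (4 * \<nu>)"
    using \<nu> by (intro divide_right_mono) auto
  moreover have "(8 * \<nu>\<^sup>2 + 9 * \<nu> + 2) / (4 * \<nu>) = 2 * \<nu> + 9 / 4 + 1 / (2 * \<nu>)"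
    using \<nu> by (simp add: field_simps power2_eq_square)
  ultimately have "2 * \<nu> + 9 / 4 + 1 / (2 * \<nu>) \<le> 7 / (4 * \<nu>)" by simp
  then have "M * (2 * \<nu> + 9 / 4 + 1 / (2 * \<nu>)) \<le> M * (7 / (4 * \<nu>))"
    using M by (intro mult_left_mono) auto
  moreover have "M * (7 / (4 * \<nu>)) = 7 * \<beta> / (4 * \<nu>) * (t * (t - 1))"
    by (simp add: M_def)
  moreover have "M * (2 * \<nu> + 9 / 4 + 1 / (2 * \<nu>)) = 2 * (\<nu> * M) + 9 / 4 * M + M / (2 * \<nu>)"
    by (simp add: algebra_simps)
  ultimately have "2 * (\<nu> * M) + 9 / 4 * M + M / (2 * \<nu>) \<le> 7 * \<beta> / (4 * \<nu>) * (t * (t - 1))"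
    by linarith
  then show ?thesis using 1 2 3 4 5 by linarith
qed

text \<open>
  Here \<open>s\<close> is \<open>t\<close> at the previous step. The coefficient of \<open>|x - z|\<^sup>2\<close> is the multiple that raises the weight of
  the distance term from \<open>1 - 2 \<nu>\<close> to \<open>1\<close>, in units of \<open>1 / (2 \<nu> \<eta>)\<close>.
\<close>

definition potential ::
    "real \<Rightarrow> real \<Rightarrow> real \<Rightarrow> real \<Rightarrow> 'a \<Rightarrow> 'a \<Rightarrow> 'a \<Rightarrow> 'a::real_inner \<Rightarrow> real" where
  "potential \<nu> \<beta> s \<eta> xs g x z =
     s * inner g (x - z) + (norm (z - xs))\<^sup>2 / (2 * \<nu> * \<eta>)
     + \<nu> / ((1 - \<nu>) * \<eta>) * (norm (x - z))\<^sup>2 + \<beta> * s * (s - 1) * (norm g)\<^sup>2"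

text \<open>
  Along a step, \<open>x' - x\<close> is a combination of \<open>x - z\<close> and \<open>G + e\<close>, and also one of \<open>x' - z'\<close> and \<open>G + e\<close>.
  Inserting the first next to \<open>G\<close> and the second next to \<open>G'\<close> turns \<open>t (t - 1) \<langle>G' - G, x' - x\<rangle>\<close>
  into a difference of the leading terms of the potential. Here \<open>E\<close> stands for the surplus in the
  co-coercivity, which is kept to pay for the change of the components.
\<close>

lemma potential_step:
  fixes x z xs G G' e x' z' y :: "'a::real_inner" and \<nu> \<beta> t \<eta> \<eta>' B E :: real
  assumes \<nu>: "0 < \<nu>" "\<nu> < 1 / 3" and \<beta>: "\<beta> > 0" and t: "t > 1"
    and \<eta>: "\<eta> = 2 * \<beta> * (t - 1) / (t - \<nu>)"
    and \<eta>': "\<eta>' = 2 * \<beta> * (t + 2 * \<nu> - 1) / (t + 2 * \<nu> - \<nu>)"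
    and B: "\<beta> * ((1 + \<nu>) / (1 - \<nu>)) \<le> B"
    and y: "y = ((t - 1) / t) *\<^sub>R x + (1 / t) *\<^sub>R z"
    and x': "x' = y - \<eta> *\<^sub>R (G + e)" and z': "z' = z + \<nu> *\<^sub>R (x' - y)"
    and mono: "inner (G' - G) (x' - x) \<ge> B * (norm (G' - G))\<^sup>2 + E"
    and sol: "inner G (x - xs) \<ge> B * (norm G)\<^sup>2"
  shows "potential \<nu> \<beta> t \<eta>' xs G' x' z' \<le>
    potential \<nu> \<beta> (t - 2 * \<nu>) \<eta> xs G x z + 7 * \<beta> / (4 * \<nu>) * (t * (t - 1)) * (norm e)\<^sup>2 - t * (t - 1) * E"
proof -
  note b = step_size_bounds[OF \<nu> \<beta> t \<eta>]
  define \<tau> where "\<tau> = t - 1"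
  define q where "q = x - z"
  define q' where "q' = x' - z'"
  define Z where "Z = z - xs"
  define Z' where "Z' = z' - xs"
  define g where "g = G + e"
  define \<theta> where "\<theta> = \<nu> / (1 - \<nu>)"
  define d where "d = (1 - \<nu>) / (2 * \<beta> * \<tau> * (\<tau> + 2 * \<nu>))"
  define h where "h = \<nu> * (1 - \<nu>) * \<eta> / (2 * t - 1)"
  have \<tau>: "\<tau> > 0" using t by (simp add: \<tau>_def)
  have \<theta>: "\<theta> > 0" using \<nu> by (simp add: \<theta>_def)
  have d: "d > 0" using \<nu> \<beta> \<tau> by (simp add: d_def)

  have q': "q' = (\<tau> / t) *\<^sub>R q - ((1 - \<nu>) * \<eta>) *\<^sub>R g"
    using t by (simp add: q'_def z' x' y q_def g_def \<tau>_def algebra_simps diff_divide_distrib)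
  have Z': "Z' = Z - (\<nu> * \<eta>) *\<^sub>R g"
    by (simp add: Z'_def Z_def z' x' g_def algebra_simps)
  have dx: "x' - x = - ((1 / t) *\<^sub>R q) - \<eta> *\<^sub>R g"
    using t by (simp add: x' y q_def g_def algebra_simps diff_divide_distrib)
  have dx1: "(t * \<tau>) *\<^sub>R (x' - x) = - (\<tau> *\<^sub>R q) - (\<eta> * t * \<tau>) *\<^sub>R g"
    unfolding dx using t by (simp add: algebra_simps)
  have dx2: "(t * \<tau>) *\<^sub>R (x' - x) = - (t *\<^sub>R q') - (2 * \<beta> * t * \<tau>) *\<^sub>R g"
  proof -
    have 1: "\<eta> * t * \<tau> = 2 * \<beta> * t * \<tau> - t * ((1 - \<nu>) * \<eta>)"
    proof -
      have "\<eta> * \<tau> = 2 * \<beta> * \<tau> - (1 - \<nu>) * \<eta>" using b(4) by (simp add: \<tau>_def algebra_simps)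
      then have "t * (\<eta> * \<tau>) = t * (2 * \<beta> * \<tau> - (1 - \<nu>) * \<eta>)" by simp
      then show ?thesis by (simp add: algebra_simps)
    qed
    show ?thesis
      unfolding dx1 q' 1 using t by (simp add: algebra_simps)
  qed
  have i: "t * inner G' q' = \<tau> * inner G q + \<eta> * t * \<tau> * inner G g - 2 * \<beta> * t * \<tau> * inner G' g
      - t * \<tau> * inner (G' - G) (x' - x)"
    using arg_cong[OF dx1, of "inner G"] arg_cong[OF dx2, of "inner G'"]
    by (simp add: inner_diff_left inner_diff_right algebra_simps)
  have nZ: "(norm Z')\<^sup>2 = (norm Z)\<^sup>2 - 2 * (\<nu> * \<eta>) * inner g Z + (\<nu> * \<eta>)\<^sup>2 * (norm g)\<^sup>2"
    unfolding Z' power2_norm_eq_inner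
    by (simp add: inner_diff_left inner_diff_right inner_commute[of Z g] algebra_simps power2_eq_square)
  have nq: "(norm q')\<^sup>2 = (\<tau> / t)\<^sup>2 * (norm q)\<^sup>2 - 2 * (\<tau> / t) * ((1 - \<nu>) * \<eta>) * inner q g
      + ((1 - \<nu>) * \<eta>)\<^sup>2 * (norm g)\<^sup>2"
  proof -
    have "(norm (a *\<^sub>R q - c *\<^sub>R g))\<^sup>2 = a\<^sup>2 * (norm q)\<^sup>2 - 2 * a * c * inner q g + c\<^sup>2 * (norm g)\<^sup>2" for a c
      unfolding power2_norm_eq_inner
      by (simp add: inner_diff_left inner_diff_right inner_commute[of g q] algebra_simps power2_eq_square)
    then show ?thesis unfolding q' .
  qed
  have ii: "((norm Z')\<^sup>2 - (norm Z)\<^sup>2) / (2 * \<nu> * \<eta>) = - inner g Z + \<nu> * \<eta> / 2 * (norm g)\<^sup>2"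
    unfolding nZ using b(1) \<nu> by (simp add: field_simps power2_eq_square)
  \<comment> \<open>Because \<open>\<theta> (1 - \<nu>) = \<nu>\<close>, the multiples of \<open>\<langle>G, q\<rangle>\<close> here, in \<open>i\<close>, in \<open>iv\<close> and in the old potential leave only \<open>2 \<nu> / t\<close>.\<close>
  have iii: "\<theta> / \<eta> * ((norm q')\<^sup>2 - (norm q)\<^sup>2) = - (\<theta> * (2 * t - 1) / (\<eta> * t\<^sup>2)) * (norm q)\<^sup>2
     - 2 * \<nu> * (\<tau> / t) * inner q g + \<nu> * (1 - \<nu>) * \<eta> * (norm g)\<^sup>2"
  proof -
    have "\<theta> / \<eta> * ((norm q')\<^sup>2 - (norm q)\<^sup>2) = \<theta> / \<eta> * ((\<tau> / t)\<^sup>2 - 1) * (norm q)\<^sup>2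
      - 2 * (\<tau> / t) * (\<theta> * (1 - \<nu>)) * (\<eta> / \<eta>) * inner q g
      + (\<theta> * (1 - \<nu>)) * (1 - \<nu>) * (\<eta>\<^sup>2 / \<eta>) * (norm g)\<^sup>2"
      unfolding nq by (simp add: algebra_simps power2_eq_square)
    moreover have "(\<tau> / t)\<^sup>2 - 1 = - ((2 * t - 1) / t\<^sup>2)"
      using t by (simp add: \<tau>_def field_simps power2_eq_square)
    moreover have "\<theta> * (1 - \<nu>) = \<nu>" using \<nu> by (simp add: \<theta>_def)
    ultimately show ?thesis using b(1) by (simp add: power2_eq_square mult_ac)
  qed
  \<comment> \<open>The error is paired with \<open>Z'\<close> rather than \<open>Z\<close>, because the decrease of \<open>1 / \<eta>\<close> is available for \<open>Z'\<close>.\<close>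
  have iv: "inner g Z = inner G (x - xs) - inner G q + inner e Z' + \<nu> * \<eta> * inner e g"
    unfolding Z' by (simp add: g_def Z_def q_def inner_add_left inner_diff_right algebra_simps)

  have inv_drop: "1 / (2 * \<nu> * \<eta>') = 1 / (2 * \<nu> * \<eta>) - d"
  proof -
    have "1 / \<eta> - 1 / \<eta>' = (\<tau> + (1 - \<nu>)) / (2 * \<beta> * \<tau>) - (\<tau> + 2 * \<nu> + (1 - \<nu>)) / (2 * \<beta> * (\<tau> + 2 * \<nu>))"
      unfolding \<eta> \<eta>' by (simp add: \<tau>_def algebra_simps)
    also have "\<dots> = 2 * \<nu> * d"
      using \<nu> \<beta> \<tau> unfolding d_def by (simp add: divide_simps) (simp add: algebra_simps)
    finally have "(1 / \<eta> - 1 / \<eta>') / (2 * \<nu>) = d" using \<nu> by simp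
    then show ?thesis by (simp add: diff_divide_distrib mult_ac)
  qed
  then have "1 / (2 * \<nu> * \<eta>') \<le> 1 / (2 * \<nu> * \<eta>)" using d by simp
  then have inv_le: "1 / \<eta>' \<le> 1 / \<eta>"
    using mult_left_mono[of "1 / (2 * \<nu> * \<eta>')" "1 / (2 * \<nu> * \<eta>)" "2 * \<nu>"] \<nu> by simp
  have P': "potential \<nu> \<beta> t \<eta>' xs G' x' z' \<le> t * inner G' q' + (norm Z')\<^sup>2 / (2 * \<nu> * \<eta>) - d * (norm Z')\<^sup>2
     + \<theta> / \<eta> * (norm q')\<^sup>2 + \<beta> * t * \<tau> * (norm G')\<^sup>2"
  proof -
    have "(norm Z')\<^sup>2 / (2 * \<nu> * \<eta>') = (norm Z')\<^sup>2 / (2 * \<nu> * \<eta>) - d * (norm Z')\<^sup>2"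
      using arg_cong[OF inv_drop, of "\<lambda>a. (norm Z')\<^sup>2 * a"] by (simp add: algebra_simps)
    moreover have "\<theta> / \<eta>' * (norm q')\<^sup>2 \<le> \<theta> / \<eta> * (norm q')\<^sup>2"
      using mult_left_mono[OF inv_le, of "\<theta> * (norm q')\<^sup>2"] \<theta> by simp
    ultimately show ?thesis
      by (simp add: potential_def \<theta>_def q'_def[symmetric] Z'_def[symmetric] \<tau>_def[symmetric])
  qed
  have P: "potential \<nu> \<beta> (t - 2 * \<nu>) \<eta> xs G x z = (t - 2 * \<nu>) * inner G q + (norm Z)\<^sup>2 / (2 * \<nu> * \<eta>)
     + \<theta> / \<eta> * (norm q)\<^sup>2 + \<beta> * (t - 2 * \<nu>) * (t - 2 * \<nu> - 1) * (norm G)\<^sup>2"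
    by (simp add: potential_def \<theta>_def q_def[symmetric] Z_def[symmetric])

  \<comment> \<open>Young's inequality four times: \<open>Y1\<close> spends the decrease of \<open>1 / \<eta>\<close>, \<open>Y2\<close> the decrease of \<open>|q|\<^sup>2\<close>, \<open>Y3\<close> the gap between \<open>B\<close> and \<open>\<beta>\<close>, and \<open>Y4\<close> the negative multiple of \<open>|G|\<^sup>2\<close>.\<close>
  have Y1: "- inner e Z' - d * (norm Z')\<^sup>2 \<le> \<beta> * \<tau> * (\<tau> + 2 * \<nu>) / (2 * (1 - \<nu>)) * (norm e)\<^sup>2"
  proof -
    have 1: "1 / (4 * d) = \<beta> * \<tau> * (\<tau> + 2 * \<nu>) / (2 * (1 - \<nu>))"
      using \<nu> \<beta> \<tau> by (auto simp: d_def divide_simps)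
    have "- inner e Z' - d * (norm Z')\<^sup>2 \<le> (norm e)\<^sup>2 / (4 * d)"
      using young_inner[OF d, of Z' "- e"] by (simp add: inner_commute[of Z' e])
    also have "\<dots> = 1 / (4 * d) * (norm e)\<^sup>2" by simp
    finally show ?thesis unfolding 1 .
  qed
  have Y2: "2 * \<nu> / t * inner q G - 2 * \<nu> * \<tau> / t * inner q e - \<theta> * (2 * t - 1) / (\<eta> * t\<^sup>2) * (norm q)\<^sup>2
      \<le> h * ((norm G)\<^sup>2 - 2 * \<tau> * inner G e + \<tau>\<^sup>2 * (norm e)\<^sup>2)"
  proof -
    define c where "c = \<theta> * (2 * t - 1) / (\<eta> * t\<^sup>2)"
    have c: "c > 0" using \<theta> t b(1) by (simp add: c_def)
    have 1: "h = (2 * \<nu> / t)\<^sup>2 / (4 * c)"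
      using \<nu> b(1) t by (simp add: c_def \<theta>_def h_def field_simps power2_eq_square)
    have 2: "(norm ((2 * \<nu> / t) *\<^sub>R (G - \<tau> *\<^sub>R e)))\<^sup>2
        = (2 * \<nu> / t)\<^sup>2 * ((norm G)\<^sup>2 - 2 * \<tau> * inner G e + \<tau>\<^sup>2 * (norm e)\<^sup>2)"
    proof -
      have "(norm (G - \<tau> *\<^sub>R e))\<^sup>2 = (norm G)\<^sup>2 - 2 * \<tau> * inner G e + \<tau>\<^sup>2 * (norm e)\<^sup>2"
        unfolding power2_norm_eq_inner
        by (simp add: inner_diff_left inner_diff_right inner_commute[of e G] power2_eq_square algebra_simps)
      then show ?thesis by (simp only: norm_scaleR power_mult_distrib power2_abs)
    qed
    have "(norm ((2 * \<nu> / t) *\<^sub>R (G - \<tau> *\<^sub>R e)))\<^sup>2 / (4 * c)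
       = h * ((norm G)\<^sup>2 - 2 * \<tau> * inner G e + \<tau>\<^sup>2 * (norm e)\<^sup>2)"
      unfolding 2 1 by simp
    then show ?thesis
      using young_inner[OF c, of q "(2 * \<nu> / t) *\<^sub>R (G - \<tau> *\<^sub>R e)"] unfolding c_def
      by (simp add: inner_diff_right algebra_simps)
  qed
  have Y3: "(\<beta> - B) * (norm (G' - G))\<^sup>2 - 2 * \<beta> * inner (G' - G) e \<le> \<beta> * (1 - \<nu>) / (2 * \<nu>) * (norm e)\<^sup>2"
  proof -
    define c where "c = 2 * \<beta> * \<nu> / (1 - \<nu>)"
    have c: "c > 0" using \<nu> \<beta> by (simp add: c_def)
    have "\<beta> + c = \<beta> * ((1 + \<nu>) / (1 - \<nu>))" using \<nu> by (simp add: c_def field_simps)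
    then have "\<beta> - B \<le> - c" using B by simp
    then have "(\<beta> - B) * (norm (G' - G))\<^sup>2 \<le> - c * (norm (G' - G))\<^sup>2"
      by (intro mult_right_mono) auto
    moreover have "(norm ((2 * \<beta>) *\<^sub>R e))\<^sup>2 / (4 * c) = \<beta> * (1 - \<nu>) / (2 * \<nu>) * (norm e)\<^sup>2"
      using \<beta> \<nu> by (simp add: c_def power_mult_distrib field_simps power2_eq_square)
    ultimately show ?thesis
      using young_inner[OF c, of "G' - G" "- ((2 * \<beta>) *\<^sub>R e)"] by simp
  qed
  define m where "m = (\<eta> - 2 * \<beta>) * t * \<tau> - \<nu> * \<eta> + 2 * \<nu> * \<eta> * (3 / 2 - \<nu>) - 2 * h * \<tau>"
  have Y4: "m * inner G e - \<beta> / 2 * (norm G)\<^sup>2 \<le> 2 * \<beta> * \<tau>\<^sup>2 * (norm e)\<^sup>2"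
  proof -
    have "\<bar>m\<bar> \<le> 2 * \<beta> * \<tau>"
      using coefficient_Ge[OF \<nu> \<beta> t \<eta>] by (simp add: m_def h_def \<tau>_def)
    then have "m\<^sup>2 \<le> (2 * \<beta> * \<tau>)\<^sup>2" by (rule abs_le_square_iff[THEN iffD1, OF order_trans]) simp
    then have "m\<^sup>2 * (norm e)\<^sup>2 / (2 * \<beta>) \<le> (2 * \<beta> * \<tau>)\<^sup>2 * (norm e)\<^sup>2 / (2 * \<beta>)"
      using \<beta> by (intro divide_right_mono mult_right_mono) auto
    also have "\<dots> = 2 * \<beta> * \<tau>\<^sup>2 * (norm e)\<^sup>2"
      using \<beta> by (simp add: power2_eq_square)
    finally show ?thesis
      using young_inner[of "\<beta> / 2" G "m *\<^sub>R e"] \<beta> by (simp add: power_mult_distrib)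
  qed
  have GG: "(\<eta> * t * \<tau> - \<beta> * t * \<tau> - \<beta> * (t - 2 * \<nu>) * (t - 2 * \<nu> - 1) - B
     + \<nu> * \<eta> * (3 / 2 - \<nu>) + h) * (norm G)\<^sup>2 \<le> - (\<beta> / 2) * (norm G)\<^sup>2"
    using coefficient_GG[OF \<nu> \<beta> t \<eta> B] unfolding h_def \<tau>_def by (intro mult_right_mono) auto
  have ee: "(\<nu> * \<eta> * (1 / 2 - \<nu>) + h * \<tau>\<^sup>2 + \<beta> * \<tau> * (\<tau> + 2 * \<nu>) / (2 * (1 - \<nu>))
     + t * \<tau> * (\<beta> * (1 - \<nu>) / (2 * \<nu>)) + 2 * \<beta> * \<tau>\<^sup>2) * (norm e)\<^sup>2
     \<le> (7 * \<beta> / (4 * \<nu>) * (t * \<tau>)) * (norm e)\<^sup>2"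
  proof (rule mult_right_mono)
    have 1: "t * \<tau> * (\<beta> * (1 - \<nu>) / (2 * \<nu>)) = \<beta> * t * \<tau> * (1 - \<nu>) / (2 * \<nu>)" by simp
    show "\<nu> * \<eta> * (1 / 2 - \<nu>) + h * \<tau>\<^sup>2 + \<beta> * \<tau> * (\<tau> + 2 * \<nu>) / (2 * (1 - \<nu>))
     + t * \<tau> * (\<beta> * (1 - \<nu>) / (2 * \<nu>)) + 2 * \<beta> * \<tau>\<^sup>2 \<le> 7 * \<beta> / (4 * \<nu>) * (t * \<tau>)"
      using coefficient_ee[OF \<nu> \<beta> t \<eta>] unfolding 1 unfolding h_def \<tau>_def .
  qed simp
  have Y3': "t * \<tau> * ((\<beta> - B) * (norm (G' - G))\<^sup>2 - 2 * \<beta> * inner (G' - G) e)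
     \<le> t * \<tau> * (\<beta> * (1 - \<nu>) / (2 * \<nu>) * (norm e)\<^sup>2)"
    using Y3 t \<tau> by (intro mult_left_mono) auto
  have mono': "t * \<tau> * (B * (norm (G' - G))\<^sup>2 + E) \<le> t * \<tau> * inner (G' - G) (x' - x)"
    using mono t \<tau> by (intro mult_left_mono) auto
  have polar: "2 * inner G' G = (norm G')\<^sup>2 + (norm G)\<^sup>2 - (norm (G' - G))\<^sup>2"
    unfolding power2_norm_eq_inner by (simp add: inner_diff_left inner_diff_right inner_commute)
  have gg: "(norm g)\<^sup>2 = (norm G)\<^sup>2 + 2 * inner G e + (norm e)\<^sup>2" "inner G g = (norm G)\<^sup>2 + inner G e"
    "inner G' g = inner G' G + inner (G' - G) e + inner G e" "inner e g = inner G e + (norm e)\<^sup>2"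
    "inner q g = inner q G + inner q e"
    unfolding power2_norm_eq_inner g_def
    by (simp_all add: inner_add_left inner_add_right inner_diff_left inner_diff_right inner_commute)
  have qG: "\<tau> * inner G q = t * inner G q - inner G q"
    by (simp add: \<tau>_def algebra_simps)
  have "2 * \<nu> / t * inner q G = 2 * \<nu> * inner q G - 2 * \<nu> * (\<tau> / t) * inner q G"
    using t by (simp add: \<tau>_def field_simps)
  then have qt: "2 * \<nu> / t * inner q G = 2 * \<nu> * inner G q - 2 * \<nu> * (\<tau> / t) * inner q G"
    by (simp add: inner_commute)
  have "potential \<nu> \<beta> t \<eta>' xs G' x' z' - potential \<nu> \<beta> (t - 2 * \<nu>) \<eta> xs G x z
      \<le> t * inner G' q' - (t - 2 * \<nu>) * inner G q + ((norm Z')\<^sup>2 - (norm Z)\<^sup>2) / (2 * \<nu> * \<eta>)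
        - d * (norm Z')\<^sup>2 + \<theta> / \<eta> * ((norm q')\<^sup>2 - (norm q)\<^sup>2)
        + \<beta> * t * \<tau> * (norm G')\<^sup>2 - \<beta> * (t - 2 * \<nu>) * (t - 2 * \<nu> - 1) * (norm G)\<^sup>2"
    using P' unfolding P diff_divide_distrib right_diff_distrib by linarith
  also have "\<dots> = (2 * \<nu> * inner G q - 2 * \<nu> * (\<tau> / t) * inner q G)
       - 2 * \<nu> * (\<tau> / t) * inner q e - \<theta> * (2 * t - 1) / (\<eta> * t\<^sup>2) * (norm q)\<^sup>2
      - inner e Z' - d * (norm Z')\<^sup>2
      + (\<eta> * t * \<tau> - \<beta> * (t - 2 * \<nu>) * (t - 2 * \<nu> - 1) + \<nu> * \<eta> * (3 / 2 - \<nu>)) * (norm G)\<^sup>2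
      + (\<eta> * t * \<tau> - 2 * \<beta> * t * \<tau> - \<nu> * \<eta> + 2 * \<nu> * \<eta> * (3 / 2 - \<nu>)) * inner G e
      + \<nu> * \<eta> * (1 / 2 - \<nu>) * (norm e)\<^sup>2
      + \<beta> * t * \<tau> * ((norm G')\<^sup>2 - 2 * inner G' G) - 2 * \<beta> * t * \<tau> * inner (G' - G) e
      - inner G (x - xs) - t * \<tau> * inner (G' - G) (x' - x)"
    unfolding i ii iii iv gg qG by (simp add: algebra_simps add_divide_distrib)
  also have "\<dots> \<le> h * ((norm G)\<^sup>2 - 2 * \<tau> * inner G e + \<tau>\<^sup>2 * (norm e)\<^sup>2)
      + \<beta> * \<tau> * (\<tau> + 2 * \<nu>) / (2 * (1 - \<nu>)) * (norm e)\<^sup>2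
      + (\<eta> * t * \<tau> - \<beta> * (t - 2 * \<nu>) * (t - 2 * \<nu> - 1) + \<nu> * \<eta> * (3 / 2 - \<nu>)) * (norm G)\<^sup>2
      + (\<eta> * t * \<tau> - 2 * \<beta> * t * \<tau> - \<nu> * \<eta> + 2 * \<nu> * \<eta> * (3 / 2 - \<nu>)) * inner G e
      + \<nu> * \<eta> * (1 / 2 - \<nu>) * (norm e)\<^sup>2
      + \<beta> * t * \<tau> * ((norm (G' - G))\<^sup>2 - (norm G)\<^sup>2) - 2 * \<beta> * t * \<tau> * inner (G' - G) e
      - B * (norm G)\<^sup>2 - t * \<tau> * (B * (norm (G' - G))\<^sup>2 + E)"
  proof -
    have "(norm G')\<^sup>2 - 2 * inner G' G = (norm (G' - G))\<^sup>2 - (norm G)\<^sup>2" using polar by simp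
    then show ?thesis
      using Y1 Y2[unfolded qt] sol mono' by (simp only:) (simp add: mult.commute)
  qed
  also have "\<dots> = (\<eta> * t * \<tau> - \<beta> * t * \<tau> - \<beta> * (t - 2 * \<nu>) * (t - 2 * \<nu> - 1) - B
          + \<nu> * \<eta> * (3 / 2 - \<nu>) + h) * (norm G)\<^sup>2 + m * inner G e
      + (\<nu> * \<eta> * (1 / 2 - \<nu>) + h * \<tau>\<^sup>2 + \<beta> * \<tau> * (\<tau> + 2 * \<nu>) / (2 * (1 - \<nu>))) * (norm e)\<^sup>2
      + t * \<tau> * ((\<beta> - B) * (norm (G' - G))\<^sup>2 - 2 * \<beta> * inner (G' - G) e) - t * \<tau> * E"
    unfolding m_def by (simp add: ring_distribs)
  also have "\<dots> \<le> 7 * \<beta> / (4 * \<nu>) * (t * \<tau>) * (norm e)\<^sup>2 - t * \<tau> * E"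
    using GG Y4 Y3' ee unfolding ring_distribs by linarith
  finally show ?thesis by (simp add: \<tau>_def)
qed

text \<open>
  Splitting \<open>x - z = (x - x\<^sup>\<star>) - (z - x\<^sup>\<star>)\<close>, the first part makes up for \<open>s (s - 1)\<close> falling short of \<open>s\<^sup>2\<close>,
  and the second is bounded by the distance term at the price of \<open>\<nu> \<beta> s\<^sup>2 |g|\<^sup>2\<close>.
\<close>

lemma potential_ge:
  fixes g x z xs :: "'a::real_inner"
  assumes \<nu>: "0 < \<nu>" "\<nu> < 1 / 3" and \<beta>: "\<beta> > 0" and s: "s > 0" and \<eta>: "0 < \<eta>" "\<eta> \<le> 2 * \<beta>"
    and B: "\<beta> \<le> B" and sol: "inner g (x - xs) \<ge> B * (norm g)\<^sup>2"
  shows "\<beta> / 2 * s\<^sup>2 * (norm g)\<^sup>2 \<le> potential \<nu> \<beta> s \<eta> xs g x z"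
proof -
  have c: "1 / (2 * \<nu> * \<eta>) > 0" using \<nu> \<eta> by simp
  have "inner (z - xs) (s *\<^sub>R g) - (norm (z - xs))\<^sup>2 / (2 * \<nu> * \<eta>) \<le> (norm (s *\<^sub>R g))\<^sup>2 / (4 * (1 / (2 * \<nu> * \<eta>)))"
    using young_inner[OF c, of "z - xs" "s *\<^sub>R g"] by simp
  also have "\<dots> = \<nu> * \<eta> / 2 * (s\<^sup>2 * (norm g)\<^sup>2)"
    by (simp add: power_mult_distrib)
  also have "\<dots> \<le> \<beta> / 2 * (s\<^sup>2 * (norm g)\<^sup>2)"
  proof (rule mult_right_mono)
    have "\<nu> * \<eta> \<le> (1 / 3) * (2 * \<beta>)" using \<nu> \<eta> by (intro mult_mono) auto
    then show "\<nu> * \<eta> / 2 \<le> \<beta> / 2" using \<beta> by simp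
  qed simp
  finally have 1: "s * inner g (z - xs) - (norm (z - xs))\<^sup>2 / (2 * \<nu> * \<eta>) \<le> \<beta> / 2 * (s\<^sup>2 * (norm g)\<^sup>2)"
    by (simp add: inner_commute)
  have "\<beta> * (norm g)\<^sup>2 \<le> B * (norm g)\<^sup>2" using B by (intro mult_right_mono) auto
  then have "s * (\<beta> * (norm g)\<^sup>2) \<le> s * inner g (x - xs)"
    using sol s by (intro mult_left_mono) auto
  moreover have "inner g (x - z) = inner g (x - xs) - inner g (z - xs)"
    by (simp add: inner_diff_right)
  moreover have "\<nu> / ((1 - \<nu>) * \<eta>) * (norm (x - z))\<^sup>2 \<ge> 0" using \<nu> \<eta> by simp
  ultimately show ?thesis
    using 1 unfolding potential_def by (simp add: algebra_simps power2_eq_square)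
qed


section \<open>Variance of mini-batches and snapshots\<close>

definition comp_gap :: "nat \<Rightarrow> (nat \<Rightarrow> 'a \<Rightarrow> 'a) \<Rightarrow> 'a \<Rightarrow> 'a::real_normed_vector \<Rightarrow> real" where
  "comp_gap n F x y = 1 / real n * (\<Sum>i = 1..n. (norm (F i x - F i y))\<^sup>2)"

lemma comp_gap_nonneg: "comp_gap n F x y \<ge> 0"
  by (simp add: comp_gap_def sum_nonneg)

lemma batches_finite: "finite (batches n b)"
  using finite_lists_length_eq[of "{1..n}" b] by (simp add: batches_def conj_commute)

lemma card_batches: "card (batches n b) = n ^ b"
  using card_lists_length_eq[of "{1..n}" b] by (simp add: batches_def conj_commute)

lemma batches_nonempty: "n \<ge> 1 \<Longrightarrow> batches n b \<noteq> {}"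
  using card_batches[of n b] by auto

lemma sum_batches_Suc:
  "(\<Sum>S\<in>batches n (Suc b). f S) = (\<Sum>i = 1..n. \<Sum>S\<in>batches n b. f (i # S))"
proof -
  have "batches n (Suc b) = (\<lambda>(i, S). i # S) ` ({1..n} \<times> batches n b)"
    by (force simp: batches_def length_Suc_conv)
  moreover have "inj_on (\<lambda>(i, S). i # S) ({1..n} \<times> batches n b)"
    by (auto simp: inj_on_def)
  ultimately show ?thesis
    by (simp add: sum.reindex sum.cartesian_product case_prod_unfold)
qed

text \<open>
  Up to normalisation, the variance of a sum of \<open>b\<close> independent uniform draws from a centred family is \<open>b\<close>
  times that of one draw. Both sides carry a factor \<open>n\<close> to avoid the power \<open>b - 1\<close>.
\<close>

lemma sum_batches_centered:
  fixes c :: "nat \<Rightarrow> 'a::real_inner"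
  assumes "(\<Sum>i = 1..n. c i) = 0"
  shows "real n * (\<Sum>S\<in>batches n b. (norm (\<Sum>i\<leftarrow>S. c i))\<^sup>2) = real b * real n ^ b * (\<Sum>i = 1..n. (norm (c i))\<^sup>2)"
proof (induction b)
  case 0
  have "batches n 0 = {[]}" by (auto simp: batches_def)
  then show ?case by simp
next
  case (Suc b)
  let ?C = "\<Sum>i = 1..n. (norm (c i))\<^sup>2" and ?Q = "\<Sum>S\<in>batches n b. (norm (\<Sum>i\<leftarrow>S. c i))\<^sup>2"
  have "(\<Sum>S\<in>batches n (Suc b). (norm (\<Sum>i\<leftarrow>S. c i))\<^sup>2)
      = (\<Sum>i = 1..n. \<Sum>S\<in>batches n b. (norm (c i))\<^sup>2 + 2 * inner (c i) (\<Sum>i\<leftarrow>S. c i) + (norm (\<Sum>i\<leftarrow>S. c i))\<^sup>2)"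
    unfolding sum_batches_Suc
    by (intro sum.cong refl)
      (simp add: power2_norm_eq_inner inner_add_left inner_add_right inner_commute)
  also have "\<dots> = real n ^ b * ?C
      + 2 * inner (\<Sum>i = 1..n. c i) (\<Sum>S\<in>batches n b. \<Sum>i\<leftarrow>S. c i) + real n * ?Q"
    by (simp add: sum.distrib card_batches sum_distrib_left inner_sum_left inner_sum_right) (rule sum.swap)
  finally have "(\<Sum>S\<in>batches n (Suc b). (norm (\<Sum>i\<leftarrow>S. c i))\<^sup>2) = real n ^ b * ?C + real n * ?Q"
    using assms by simp
  then have "real n * (\<Sum>S\<in>batches n (Suc b). (norm (\<Sum>i\<leftarrow>S. c i))\<^sup>2)
      = real n * (real n ^ b * ?C) + real n * (real n * ?Q)"
    by (simp add: ring_distribs)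
  also have "\<dots> = real (Suc b) * real n ^ Suc b * ?C"
    unfolding Suc.IH by (simp add: algebra_simps)
  finally show ?case .
qed

text \<open>
  The error is the average of \<open>b\<close> independent draws of the centred differences \<open>F\<^sub>i x - F\<^sub>i xt\<close>, and centring does not
  increase the second moment.
\<close>

lemma lsvrg_variance:
  fixes F :: "nat \<Rightarrow> 'a \<Rightarrow> 'a::real_inner"
  assumes n: "n \<ge> 1" and b: "b \<ge> 1"
  shows "(\<Sum>S\<in>batches n b. (norm (lsvrg n F S x xt - mean_op n F x))\<^sup>2) / real (card (batches n b))
    \<le> comp_gap n F x xt / real b"
proof -
  define a where "a = (\<lambda>i. F i x - F i xt)"
  define m where "m = mean_op n F x - mean_op n F xt"
  define c where "c = (\<lambda>i. a i - m)"
  have suma: "(\<Sum>i = 1..n. a i) = real n *\<^sub>R m"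
    using n by (simp add: a_def m_def mean_op_def sum_subtractf scaleR_diff_right)
  then have sumc: "(\<Sum>i = 1..n. c i) = 0"
    by (simp add: c_def sum_subtractf scaleR_conv_of_real sum_constant_scaleR)
  have list: "(\<Sum>i\<leftarrow>S. c i) = (\<Sum>i\<leftarrow>S. a i) - real (length S) *\<^sub>R m" for S
    by (induction S) (auto simp: c_def algebra_simps)
  have err: "lsvrg n F S x xt - mean_op n F x = (1 / real b) *\<^sub>R (\<Sum>i\<leftarrow>S. c i)" if "S \<in> batches n b" for S
  proof -
    have "length S = b" using that by (simp add: batches_def)
    then show ?thesis
      using b unfolding list by (simp add: lsvrg_def a_def m_def scaleR_diff_right)
  qed
  have "(\<Sum>i = 1..n. (norm (c i))\<^sup>2) = (\<Sum>i = 1..n. (norm (a i))\<^sup>2 - 2 * inner (a i) m + (norm m)\<^sup>2)"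
    by (intro sum.cong refl)
      (simp add: c_def power2_norm_eq_inner inner_diff_left inner_diff_right inner_commute)
  also have "\<dots> = (\<Sum>i = 1..n. (norm (a i))\<^sup>2) - 2 * inner (\<Sum>i = 1..n. a i) m + real n * (norm m)\<^sup>2"
    by (simp add: sum.distrib sum_subtractf inner_sum_left sum_distrib_left)
  also have "\<dots> = (\<Sum>i = 1..n. (norm (a i))\<^sup>2) - real n * (norm m)\<^sup>2"
    unfolding suma by (simp add: power2_norm_eq_inner)
  finally have var: "(\<Sum>i = 1..n. (norm (c i))\<^sup>2) \<le> (\<Sum>i = 1..n. (norm (a i))\<^sup>2)" by simp
  have "(\<Sum>S\<in>batches n b. (norm (lsvrg n F S x xt - mean_op n F x))\<^sup>2) / real (card (batches n b))
    = (\<Sum>S\<in>batches n b. (norm (\<Sum>i\<leftarrow>S. c i))\<^sup>2) / (real b)\<^sup>2 / real n ^ b"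
    by (simp add: err card_batches power_divide sum_divide_distrib)
  also have "\<dots> = (1 / (real b * real n)) * (\<Sum>i = 1..n. (norm (c i))\<^sup>2)"
    using sum_batches_centered[OF sumc, of b] n b by (simp add: field_simps power2_eq_square)
  also have "\<dots> \<le> (1 / (real b * real n)) * (\<Sum>i = 1..n. (norm (a i))\<^sup>2)"
    by (intro mult_left_mono var) simp
  finally show ?thesis by (simp add: comp_gap_def a_def mult.commute)
qed

lemma power2_norm_add_le:
  fixes u v :: "'a::real_inner"
  assumes "s > 0"
  shows "(norm (u + v))\<^sup>2 \<le> (1 + 1 / s) * (norm u)\<^sup>2 + (1 + s) * (norm v)\<^sup>2"
proof -
  have "0 \<le> (norm (u - s *\<^sub>R v))\<^sup>2 / s" using assms by simp
  also have "\<dots> = (norm u)\<^sup>2 / s - 2 * inner u v + s * (norm v)\<^sup>2"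
    using assms unfolding power2_norm_eq_inner
    by (simp add: inner_diff_left inner_diff_right inner_commute[of v u] field_simps)
  finally show ?thesis
    unfolding power2_norm_eq_inner
    by (simp add: inner_add_left inner_add_right inner_commute[of v u] algebra_simps)
qed

text \<open>
  Young's inequality with parameter \<open>p / 2\<close> for the unrefreshed snapshot:
  \<open>(1 - p) (1 + p / 2) \<le> 1 - p / 2\<close> and \<open>p + (1 - p) (1 + 2 / p) \<le> 2 / p\<close>.
\<close>

lemma snapshot_gap_le:
  fixes F :: "nat \<Rightarrow> 'a \<Rightarrow> 'a::real_inner"
  assumes p: "0 < p" "p \<le> 1"
  shows "p * comp_gap n F x' x + (1 - p) * comp_gap n F x' xt
    \<le> (1 - p / 2) * comp_gap n F x xt + 2 / p * comp_gap n F x' x"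
proof -
  have "(norm (F i x' - F i xt))\<^sup>2 \<le> (1 + 2 / p) * (norm (F i x' - F i x))\<^sup>2 + (1 + p / 2) * (norm (F i x - F i xt))\<^sup>2" for i
    using power2_norm_add_le[of "p / 2" "F i x' - F i x" "F i x - F i xt"] p by simp
  then have "(\<Sum>i = 1..n. (norm (F i x' - F i xt))\<^sup>2) \<le>
      (\<Sum>i = 1..n. (1 + 2 / p) * (norm (F i x' - F i x))\<^sup>2 + (1 + p / 2) * (norm (F i x - F i xt))\<^sup>2)"
    by (rule sum_mono)
  also have "\<dots> = (1 + 2 / p) * (\<Sum>i = 1..n. (norm (F i x' - F i x))\<^sup>2) + (1 + p / 2) * (\<Sum>i = 1..n. (norm (F i x - F i xt))\<^sup>2)"
    by (simp add: sum.distrib sum_distrib_left)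
  finally have "1 / real n * (\<Sum>i = 1..n. (norm (F i x' - F i xt))\<^sup>2) \<le>
      1 / real n * ((1 + 2 / p) * (\<Sum>i = 1..n. (norm (F i x' - F i x))\<^sup>2) + (1 + p / 2) * (\<Sum>i = 1..n. (norm (F i x - F i xt))\<^sup>2))"
    by (rule mult_left_mono) simp
  then have "comp_gap n F x' xt \<le> (1 + 2 / p) * comp_gap n F x' x + (1 + p / 2) * comp_gap n F x xt"
    by (simp add: comp_gap_def add_divide_distrib)
  then have "(1 - p) * comp_gap n F x' xt \<le> (1 - p) * ((1 + 2 / p) * comp_gap n F x' x + (1 + p / 2) * comp_gap n F x xt)"
    using p by (intro mult_left_mono) auto
  also have "\<dots> = (2 / p - 1 - p) * comp_gap n F x' x + (1 - p / 2 - p\<^sup>2 / 2) * comp_gap n F x xt"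
    using p by (simp add: field_simps power2_eq_square)
  also have "\<dots> \<le> (2 / p - p) * comp_gap n F x' x + (1 - p / 2) * comp_gap n F x xt"
    using comp_gap_nonneg[of n F] by (intro add_mono mult_right_mono) auto
  finally show ?thesis by (simp add: algebra_simps)
qed

lemma expectation_bind_finite:
  fixes h :: "'b \<Rightarrow> real"
  assumes "finite (set_pmf p)" "\<And>x. x \<in> set_pmf p \<Longrightarrow> finite (set_pmf (f x))"
  shows "measure_pmf.expectation (bind_pmf p f) h = measure_pmf.expectation p (\<lambda>x. measure_pmf.expectation (f x) h)"
  using assms by (simp add: pmf_expectation_bind[OF assms(1,2)] integral_measure_pmf[OF assms(1)])

definition vfosa_next ::
    "nat \<Rightarrow> (nat \<Rightarrow> 'a \<Rightarrow> 'a) \<Rightarrow> 'a multi_op \<Rightarrow> real \<Rightarrow> real \<Rightarrow> (nat \<Rightarrow> real) \<Rightarrow> (nat \<Rightarrow> real) \<Rightarrow>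
     (nat \<Rightarrow> nat) \<Rightarrow> nat \<Rightarrow> 'a vstate \<Rightarrow> nat list \<Rightarrow> bool \<Rightarrow> 'a::real_vector vstate" where
  "vfosa_next n F T lam \<nu> t \<eta> b k s S refresh =
     (let x = cur s; z = aux s; xt = snap s;
          y = ((t k - 1) / t k) *\<^sub>R x + (1 / t k) *\<^sub>R z;
          G = fb_residual lam T (lsvrg n F S x xt) x;
          x' = y - \<eta> k *\<^sub>R G
      in VState x' (z + \<nu> *\<^sub>R (x' - y)) (if refresh then x else xt)
          (F_calls s + 2 * b k + (if refresh then n else 0)) (J_calls s + 1))"

lemma expectation_vfosa_step:
  fixes h :: "'a::real_vector vstate \<Rightarrow> real"
  assumes n: "n \<ge> 1" and p: "0 \<le> p (k + 1)" "p (k + 1) \<le> 1"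
  shows "measure_pmf.expectation (vfosa_step n F T lam \<nu> t \<eta> b p k s) h =
    (\<Sum>S\<in>batches n (b k). p (k + 1) * h (vfosa_next n F T lam \<nu> t \<eta> b k s S True)
       + (1 - p (k + 1)) * h (vfosa_next n F T lam \<nu> t \<eta> b k s S False)) / real (card (batches n (b k)))"
proof -
  have eq: "vfosa_step n F T lam \<nu> t \<eta> b p k s = bind_pmf (pmf_of_set (batches n (b k)))
     (\<lambda>S. bind_pmf (bernoulli_pmf (p (k + 1))) (\<lambda>c. return_pmf (vfosa_next n F T lam \<nu> t \<eta> b k s S c)))"
    by (simp add: vfosa_step_def vfosa_next_def Let_def)
  show ?thesis
    unfolding eq using p
    by (simp add: expectation_bind_finite batches_nonempty[OF n] batches_finite
        integral_pmf_of_set mult.commute)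
qed


section \<open>The parameters of the iteration\<close>

locale lsvrg_run =
  fixes n :: nat and F :: "nat \<Rightarrow> 'a::euclidean_space \<Rightarrow> 'a" and T :: "'a multi_op"
    and \<rho> L Lh lam \<mu> \<beta> r c\<^sub>p \<omega> :: real and x0 xs :: 'a
  assumes std: "standing_assumptions n F T \<rho> L"
    and Lh: "Lh > L" "Lh * \<rho> < 1" and lam2: "2 * \<rho> \<le> lam"
    and \<mu>: "0 < \<mu>" "\<mu> < 2 / 3"
    and \<beta>: "0 < \<beta>" and \<beta>_le: "\<beta> \<le> (2 - \<mu>) * beta_bar \<rho> Lh lam / (2 + \<mu>)"
    and r: "r > 5 + 1 / \<mu>" and cp: "c\<^sub>p > 0"
    and size: "admissible_size \<mu> r c\<^sub>p (c_b L Lh \<mu> \<beta> c\<^sub>p) n \<omega>"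
    and xs: "xs \<in> zer (sum_op (mean_op n F) T)"
begin

abbreviation "\<nu> \<equiv> \<mu> / 2"
abbreviation "t \<equiv> t_seq \<mu> r"
abbreviation "\<eta> \<equiv> eta_seq \<mu> \<beta> r"
abbreviation "b \<equiv> batch_size (c_b L Lh \<mu> \<beta> c\<^sub>p) n \<omega>"
abbreviation "p \<equiv> refresh_prob \<mu> r c\<^sub>p n \<omega>"
abbreviation "B \<equiv> beta_bar \<rho> Lh lam"
abbreviation "G \<equiv> G_op lam n F T"
abbreviation "X \<equiv> vfosa_lsvrg n F T lam \<mu> \<beta> r c\<^sub>p (c_b L Lh \<mu> \<beta> c\<^sub>p) \<omega> x0"

definition "N = c\<^sub>p * real n powr \<omega>"
text \<open>
  The shift that turns the refresh probabilities into \<open>2 / N + 4 / (k + a)\<close>.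
\<close>

definition "a = r - 1 - 1 / \<mu>"

lemma n: "n \<ge> 1" and \<rho>: "\<rho> \<ge> 0" and L: "L > 0" and T_max: "maximally_cohypomonotone \<rho> T"
  using std by (auto simp: standing_assumptions_def)

lemma B: "\<beta> * ((1 + \<nu>) / (1 - \<nu>)) \<le> B" "\<beta> \<le> B"
proof -
  have "\<beta> * (2 + \<mu>) \<le> (2 - \<mu>) * B" using \<beta>_le \<mu> by (simp add: pos_le_divide_eq)
  then have "\<beta> * ((2 + \<mu>) / (2 - \<mu>)) \<le> B" using \<mu> by (simp add: pos_divide_le_eq mult.commute)
  moreover have "(1 + \<nu>) / (1 - \<nu>) = (2 + \<mu>) / (2 - \<mu>)" using \<mu> by (simp add: field_simps)
  ultimately show 1: "\<beta> * ((1 + \<nu>) / (1 - \<nu>)) \<le> B" by simp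
  have "1 \<le> (1 + \<nu>) / (1 - \<nu>)" using \<mu> by simp
  then have "\<beta> * 1 \<le> \<beta> * ((1 + \<nu>) / (1 - \<nu>))" using \<beta> by (intro mult_left_mono) auto
  then show "\<beta> \<le> B" using 1 by simp
qed

lemma lam_pos: "lam > 0"
proof (rule ccontr)
  assume "\<not> lam > 0"
  then have "lam = 0" using lam2 \<rho> by linarith
  then have "B \<le> 0" using \<rho> Lh by (simp add: beta_bar_def divide_nonpos_pos mult.commute)
  then show False using B(2) \<beta> by simp
qed

lemma lam: "\<rho> < lam" using lam2 lam_pos \<rho> by linarith

lemma Lambda_pos: "Lambda L Lh > 0"
  using Lh L by (simp add: Lambda_def)

lemma G_cocoercive:
  "inner (G x - G y) (x - y) \<ge> B * (norm (G x - G y))\<^sup>2 + Lambda L Lh * comp_gap n F x y"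
  using G_op_cocoercive[OF std lam lam_pos Lh] by (simp add: comp_gap_def)

lemma G_xs: "inner (G x) (x - xs) \<ge> B * (norm (G x))\<^sup>2"
proof -
  have "Lambda L Lh * comp_gap n F x xs \<ge> 0"
    using Lambda_pos by (simp add: comp_gap_nonneg)
  then show ?thesis
    using G_cocoercive[of x xs] G_op_zero[OF T_max lam lam_pos xs] by simp
qed

lemma a: "a > 4" "t k - 1 = \<mu> * (real k + 1 + a)" "\<mu> * (r - 1) - 1 = \<mu> * a"
  using r \<mu> by (simp_all add: a_def t_seq_def field_simps)

lemma t_gt: "t k > 1"
proof -
  have "\<mu> * (real k + 1 + a) > 0" using a(1) \<mu> by simp
  then show ?thesis using a(2)[of k] by simp
qed

lemma t_prev_gt: "t k - \<mu> > 1"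
proof -
  have "\<mu> * (real k + a) > 0" using a(1) \<mu> by simp
  then show ?thesis using a(2)[of k] by (simp add: algebra_simps)
qed

lemma \<nu>: "0 < \<nu>" "\<nu> < 1 / 3"
  using \<mu> by auto

lemma eta: "0 < \<eta> k" "\<eta> k \<le> 2 * \<beta>"
  using step_size_bounds(1,2)[OF \<nu> \<beta> t_gt[of k], of "\<eta> k"] by (auto simp: eta_seq_def)

text \<open>
  The first bound makes the refresh probabilities at most one in the first phase, the second says
  that this phase is not empty, and either the one or the other, according to whether \<open>a < 12\<close>,
  gives the third, which does the same in the second phase.
\<close>

lemma N_ge: "N \<ge> 2 * a / (a - 4)" "N \<ge> a / 4" "N \<ge> 3"
proof -
  have "real n powr \<omega> \<ge> 1 / c\<^sub>p * max ((2 * \<mu> * (r - 1) - 2) / (\<mu> * (r - 5) - 1)) ((\<mu> * (r - 1) - 1) / (4 * \<mu>))"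
    using size by (simp add: admissible_size_def)
  then have "N \<ge> max ((2 * \<mu> * (r - 1) - 2) / (\<mu> * (r - 5) - 1)) ((\<mu> * (r - 1) - 1) / (4 * \<mu>))"
    using cp by (simp add: N_def field_simps)
  moreover have "(\<mu> * (r - 1) - 1) / (4 * \<mu>) = a / 4"
    unfolding a(3) using \<mu> by simp
  moreover have "(2 * \<mu> * (r - 1) - 2) / (\<mu> * (r - 5) - 1) = 2 * a / (a - 4)"
  proof -
    have "2 * \<mu> * (r - 1) - 2 = \<mu> * (2 * a)" "\<mu> * (r - 5) - 1 = \<mu> * (a - 4)"
      using a(3) by (simp_all add: algebra_simps)
    then show ?thesis using \<mu> by simp
  qed
  ultimately show 1: "N \<ge> 2 * a / (a - 4)" and 2: "N \<ge> a / 4" by auto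
  show "N \<ge> 3"
  proof (cases "a \<ge> 12")
    case True
    then show ?thesis using 2 by linarith
  next
    case False
    then have "3 \<le> 2 * a / (a - 4)" using a(1) by (simp add: pos_le_divide_eq)
    then show ?thesis using 1 by linarith
  qed
qed

lemma refresh_prob_cases:
  obtains "real k + a \<le> 4 * N" "p k = 2 / N + 4 / (real k + a)"
  | "4 * N < real k + a" "p k = 3 / N"
proof -
  have e1: "4 * c\<^sub>p * real n powr \<omega> - r + 1 + 1 / \<mu> = 4 * N - a" by (simp add: N_def a_def)
  have e2: "4 * \<mu> / (\<mu> * (real k + r - 1) - 1) = 4 / (real k + a)"
  proof -
    have "\<mu> * (real k + r - 1) - 1 = \<mu> * (real k + a)" using \<mu> by (simp add: a_def field_simps)
    then show ?thesis using \<mu> by simp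
  qed
  have "p k = (if int k \<le> \<lfloor>4 * N - a\<rfloor> then 2 / N + 4 / (real k + a) else 3 / N)"
    unfolding refresh_prob_def e1 e2 N_def[symmetric] ..
  then show thesis using that by (auto simp: le_floor_iff split: if_splits)
qed

text \<open>
  The third bound is the one that fixes the two phases: \<open>2 / (k + a)\<close> makes up for the growth of
  \<open>t\<^sub>k\<^sup>2\<close>, and once it has dropped below \<open>1 / (2 N)\<close> the constant \<open>3 / N\<close> covers both terms.
\<close>

lemma refresh_prob_bounds:
  "3 / N \<le> p k" "p k \<le> 1" "1 / N + 2 / (real k + a) \<le> p k / 2" "p k \<le> 3 / N + (if real k + a \<le> 4 * N then 4 / (real k + a) else 0)"
proof -
  have pos: "real k + a > 0" "N > 0" using a(1) N_ge(3) by auto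
  define u v where "u = 1 / N" and "v = 1 / (real k + a)"
  have uv: "2 / N = 2 * u" "3 / N = 3 * u" "4 / (real k + a) = 4 * v" "2 / (real k + a) = 2 * v" "1 / N = u"
    by (simp_all add: u_def v_def)
  have "3 * u \<le> p k \<and> p k \<le> 1 \<and> u + 2 * v \<le> p k / 2 \<and>
     p k \<le> 3 * u + (if real k + a \<le> 4 * N then 4 * v else 0)"
  proof (cases k rule: refresh_prob_cases)
    case 1
    have "u \<le> 4 * v" using 1(1) pos by (simp add: u_def v_def field_simps)
    moreover have "2 / N \<le> 2 / (2 * a / (a - 4))"
      using N_ge(1) a(1) by (intro divide_left_mono) (auto intro!: mult_pos_pos simp: pos)
    moreover have "u \<ge> 0" using pos by (simp add: u_def)
    moreover have "2 / (2 * a / (a - 4)) = 1 - 4 / a" using a(1) by (simp add: field_simps)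
    moreover have "4 / (real k + a) \<le> 4 / a" using a(1) by (intro divide_left_mono) auto
    ultimately show ?thesis using 1 unfolding uv by auto
  next
    case 2
    have "2 * v \<le> u / 2" using 2(1) pos by (simp add: u_def v_def field_simps)
    moreover have "3 * u \<le> 1" using N_ge(3) pos by (simp add: u_def field_simps)
    ultimately show ?thesis using 2 unfolding uv by auto
  qed
  then show "3 / N \<le> p k" "p k \<le> 1" "1 / N + 2 / (real k + a) \<le> p k / 2"
    "p k \<le> 3 / N + (if real k + a \<le> 4 * N then 4 / (real k + a) else 0)"
    unfolding uv by auto
qed

text \<open>
  Rounding down a number that is at least one loses less than half of it.
\<close>

lemma batch_size_bounds:
  "b \<ge> 1" "real b \<le> c_b L Lh \<mu> \<beta> c\<^sub>p * real n powr (2 * \<omega>)"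
  "5 * \<beta> * N\<^sup>2 / (2 * \<mu>) \<le> Lambda L Lh * real b"
proof -
  let ?y = "c_b L Lh \<mu> \<beta> c\<^sub>p * real n powr (2 * \<omega>)"
  show 1: "b \<ge> 1" using size by (simp add: admissible_size_def)
  then have "0 < nat \<lfloor>?y\<rfloor>" unfolding batch_size_def by linarith
  then have "\<lfloor>?y\<rfloor> \<ge> 1" unfolding zero_less_nat_eq by linarith
  then have b: "real b = of_int \<lfloor>?y\<rfloor>" by (simp add: batch_size_def)
  show "real b \<le> ?y" unfolding b by simp
  have "?y \<le> 2 * real b" unfolding b using \<open>\<lfloor>?y\<rfloor> \<ge> 1\<close> by linarith
  then have "Lambda L Lh * ?y \<le> Lambda L Lh * (2 * real b)"
    using Lambda_pos by (intro mult_left_mono) auto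
  moreover have "Lambda L Lh * ?y = 5 * \<beta> * N\<^sup>2 / \<mu>"
  proof -
    have "real n powr (2 * \<omega>) = (real n powr \<omega>)\<^sup>2"
      by (simp add: power2_eq_square powr_add[symmetric])
    then show ?thesis using Lambda_pos by (simp add: c_b_def N_def power_mult_distrib)
  qed
  ultimately show "5 * \<beta> * N\<^sup>2 / (2 * \<mu>) \<le> Lambda L Lh * real b" by simp
qed

section \<open>The Lyapunov function is a supermartingale\<close>

text \<open>
  The weight of the snapshot gap. It is \<open>N\<close> times the error coefficient of \<open>potential_step\<close> at the
  previous time, since the gap persists for about \<open>N\<close> steps.
\<close>

definition W :: "nat \<Rightarrow> real" where
  "W k = 7 * \<beta> / (2 * \<mu>) * N * (t k - \<mu>) * (t k - \<mu> - 1)"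

definition lyapunov :: "nat \<Rightarrow> 'a vstate \<Rightarrow> real" where
  "lyapunov k s = potential \<nu> \<beta> (t k - \<mu>) (\<eta> k) xs (G (cur s)) (cur s) (aux s)
     + W k / real b * comp_gap n F (cur s) (snap s)"

lemma t_Suc: "t (Suc k) = t k + \<mu>"
  by (simp add: t_seq_def algebra_simps)

lemma W_Suc: "W (Suc k) = 7 * \<beta> / (2 * \<mu>) * N * (t k * (t k - 1))"
  by (simp add: W_def t_Suc)

lemma W_nonneg: "W k \<ge> 0"
  using \<beta> \<mu> N_ge(3) t_prev_gt[of k] by (simp add: W_def)

text \<open>
  A snapshot gap with weight \<open>W k\<close> pays for its contribution to the next weighted gap and for the
  variance of the current estimator.
\<close>

lemma W_contraction:
  "W (Suc k) * (1 - p (Suc k) / 2) + 7 * \<beta> / (2 * \<mu>) * (t k * (t k - 1)) \<le> W k"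
proof -
  define c where "c = 7 * \<beta> / (2 * \<mu>)"
  define \<tau> where "\<tau> = t k - 1"
  have c: "c \<ge> 0" using \<beta> \<mu> by (simp add: c_def)
  have pos: "t k > 1" "\<tau> > 0" "N > 0" using t_gt[of k] N_ge(3) by (auto simp: \<tau>_def)
  have "2 / (real (Suc k) + a) = 2 * \<mu> / \<tau>"
    using \<mu> a(2)[of k] by (simp add: \<tau>_def add_ac)
  then have "1 - p (Suc k) / 2 \<le> 1 - 1 / N - 2 * \<mu> / \<tau>"
    using refresh_prob_bounds(3)[of "Suc k"] by simp
  then have "N * (t k * \<tau>) * (1 - p (Suc k) / 2) \<le> N * (t k * \<tau>) * (1 - 1 / N - 2 * \<mu> / \<tau>)"
    using pos by (intro mult_left_mono) auto
  also have "\<dots> = N * (t k * \<tau>) - t k * \<tau> - 2 * \<mu> * N * t k"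
    using pos by (simp add: field_simps)
  also have "\<dots> \<le> N * ((t k - \<mu>) * (\<tau> - \<mu>)) - t k * \<tau>"
  proof -
    have "N * ((t k - \<mu>) * (\<tau> - \<mu>)) - t k * \<tau> - (N * (t k * \<tau>) - t k * \<tau> - 2 * \<mu> * N * t k) = N * (\<mu> + \<mu>\<^sup>2)"
      by (simp add: \<tau>_def algebra_simps power2_eq_square)
    moreover have "N * (\<mu> + \<mu>\<^sup>2) \<ge> 0" using pos \<mu> by simp
    ultimately show ?thesis by linarith
  qed
  finally have "c * (N * (t k * \<tau>) * (1 - p (Suc k) / 2)) \<le> c * (N * ((t k - \<mu>) * (\<tau> - \<mu>)) - t k * \<tau>)"
    using c by (rule mult_left_mono)
  moreover have "W (Suc k) = c * (N * (t k * \<tau>))"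
    unfolding W_Suc c_def \<tau>_def by (simp only: mult.assoc)
  moreover have "W k = c * (N * ((t k - \<mu>) * (\<tau> - \<mu>)))"
  proof -
    have "\<tau> - \<mu> = t k - \<mu> - 1" by (simp add: \<tau>_def)
    then show ?thesis unfolding W_def c_def by (simp only: mult.assoc)
  qed
  ultimately show ?thesis
    unfolding c_def[symmetric] \<tau>_def[symmetric] by (simp add: right_diff_distrib mult.assoc)
qed

text \<open>
  The refill of the snapshot gap is covered by the surplus in the co-coercivity. The left side is at most
  \<open>7 / 3\<close>, the right side at least \<open>5 / 2\<close> times \<open>\<beta> N\<^sup>2 t\<^sub>k (t\<^sub>k - 1) / (\<mu> b)\<close>.
\<close>

lemma W_absorbed: "W (Suc k) / real b * (2 / p (Suc k)) \<le> Lambda L Lh * (t k * (t k - 1))"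
proof -
  define M where "M = t k * (t k - 1)"
  have M: "M \<ge> 0" using t_gt[of k] by (simp add: M_def)
  have N: "N > 0" using N_ge(3) by simp
  have "p (Suc k) > 0" using refresh_prob_bounds(1)[of "Suc k"] N
    by (meson divide_pos_pos less_le_trans zero_less_numeral)
  then have "2 / p (Suc k) \<le> 2 / (3 / N)"
    using refresh_prob_bounds(1)[of "Suc k"] N by (intro divide_left_mono) auto
  then have "W (Suc k) * (2 / p (Suc k)) \<le> W (Suc k) * (2 * N / 3)"
    using W_nonneg by (intro mult_left_mono) auto
  also have "\<dots> = M * (7 * \<beta> * N\<^sup>2 / (3 * \<mu>))"
    unfolding W_Suc M_def[symmetric] by (simp add: power2_eq_square mult_ac)
  also have "\<dots> \<le> M * (5 * \<beta> * N\<^sup>2 / (2 * \<mu>))"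
    using \<beta> \<mu> M N by (intro mult_left_mono) (simp_all add: field_simps)
  also have "\<dots> \<le> M * (Lambda L Lh * real b)"
    using batch_size_bounds(3) M by (intro mult_left_mono) auto
  finally have "W (Suc k) * (2 / p (Suc k)) \<le> Lambda L Lh * M * real b" by (simp only: mult_ac)
  then have "W (Suc k) * (2 / p (Suc k)) / real b \<le> Lambda L Lh * M"
    using batch_size_bounds(1) by (subst pos_divide_le_eq) auto
  then show ?thesis by (simp add: M_def mult.commute)
qed

abbreviation "next_state \<equiv> vfosa_next n F T lam \<nu> t \<eta> (\<lambda>k. b)"

text \<open>
  For a fixed mini-batch the new point does not depend on the refresh coin, so averaging over the coin affects the
  snapshot gap only.
\<close>

lemma lyapunov_step_batch:
  "p (Suc k) * lyapunov (Suc k) (next_state k s S True)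
     + (1 - p (Suc k)) * lyapunov (Suc k) (next_state k s S False)
   \<le> potential \<nu> \<beta> (t k - \<mu>) (\<eta> k) xs (G (cur s)) (cur s) (aux s)
     + W (Suc k) / real b * ((1 - p (Suc k) / 2) * comp_gap n F (cur s) (snap s))
     + 7 * \<beta> / (2 * \<mu>) * (t k * (t k - 1)) * (norm (lsvrg n F S (cur s) (snap s) - mean_op n F (cur s)))\<^sup>2"
proof -
  define q where "q = p (Suc k)"
  have "0 < 3 / N" using N_ge(3) by simp
  then have q: "0 < q" "q \<le> 1"
    using refresh_prob_bounds(1,2)[of "Suc k"] unfolding q_def by linarith+
  define s1 where "s1 = next_state k s S True"
  define s0 where "s0 = next_state k s S False"
  define x where "x = cur s"
  define x' where "x' = cur s1"
  define z' where "z' = aux s1"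
  define e where "e = fb_residual lam T (lsvrg n F S x (snap s)) x - G x"
  define y where "y = ((t k - 1) / t k) *\<^sub>R x + (1 / t k) *\<^sub>R aux s"
  define P' where "P' = potential \<nu> \<beta> (t k) (\<eta> (Suc k)) xs (G x') x' z'"
  define P where "P = potential \<nu> \<beta> (t k - \<mu>) (\<eta> k) xs (G x) x (aux s)"
  define c where "c = 7 * \<beta> / (2 * \<mu>) * (t k * (t k - 1))"
  define D where "D = comp_gap n F x' x"
  define V where "V = W (Suc k) / real b"
  have c: "c \<ge> 0" using \<beta> \<mu> t_gt[of k] by (simp add: c_def)
  have V: "V \<ge> 0" using W_nonneg by (simp add: V_def)
  have s1: "snap s1 = x" "x' = y - \<eta> k *\<^sub>R (G x + e)" "z' = aux s + \<nu> *\<^sub>R (x' - y)"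
    by (simp_all add: s1_def x'_def z'_def x_def y_def e_def vfosa_next_def Let_def)
  have s0: "cur s0 = x'" "aux s0 = z'" "snap s0 = snap s"
    by (simp_all add: s0_def s1_def x'_def z'_def x_def vfosa_next_def Let_def)
  have \<eta>: "\<eta> k = 2 * \<beta> * (t k - 1) / (t k - \<nu>)"
    "\<eta> (Suc k) = 2 * \<beta> * (t k + 2 * \<nu> - 1) / (t k + 2 * \<nu> - \<nu>)"
    by (simp_all add: eta_seq_def t_Suc)
  have coco: "inner (G x' - G x) (x' - x) \<ge> B * (norm (G x' - G x))\<^sup>2 + Lambda L Lh * D"
    unfolding D_def by (rule G_cocoercive)
  have "P' \<le> potential \<nu> \<beta> (t k - 2 * \<nu>) (\<eta> k) xs (G x) x (aux s)
     + 7 * \<beta> / (4 * \<nu>) * (t k * (t k - 1)) * (norm e)\<^sup>2 - t k * (t k - 1) * (Lambda L Lh * D)"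
    unfolding P'_def by (rule potential_step[OF \<nu> \<beta> t_gt \<eta> B(1) y_def s1(2,3) coco G_xs])
  then have 1: "P' \<le> P + c * (norm e)\<^sup>2 - Lambda L Lh * (t k * (t k - 1)) * D"
    by (simp add: P_def c_def mult_ac)
  have "norm e \<le> norm (lsvrg n F S x (snap s) - mean_op n F x)"
    unfolding e_def G_op_def by (rule fb_residual_error_le[OF T_max lam lam_pos lam2])
  then have "(norm e)\<^sup>2 \<le> (norm (lsvrg n F S x (snap s) - mean_op n F x))\<^sup>2"
    by (intro power_mono) auto
  then have 2: "c * (norm e)\<^sup>2 \<le> c * (norm (lsvrg n F S x (snap s) - mean_op n F x))\<^sup>2"
    using c by (intro mult_left_mono) auto
  have "V * (q * D + (1 - q) * comp_gap n F x' (snap s))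
      \<le> V * ((1 - q / 2) * comp_gap n F x (snap s) + 2 / q * D)"
    unfolding D_def by (intro mult_left_mono snapshot_gap_le q V)
  also have "\<dots> = V * ((1 - q / 2) * comp_gap n F x (snap s)) + V * (2 / q) * D"
    by (simp add: ring_distribs)
  also have "V * (2 / q) * D \<le> Lambda L Lh * (t k * (t k - 1)) * D"
    using W_absorbed[of k] unfolding V_def q_def D_def
    by (intro mult_right_mono comp_gap_nonneg)
  finally have 3: "V * (q * D + (1 - q) * comp_gap n F x' (snap s)) \<le>
      V * ((1 - q / 2) * comp_gap n F x (snap s)) + Lambda L Lh * (t k * (t k - 1)) * D" by simp
  have "q * lyapunov (Suc k) s1 + (1 - q) * lyapunov (Suc k) s0
      = P' + V * (q * D + (1 - q) * comp_gap n F x' (snap s))"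
    unfolding lyapunov_def s0 s1(1) x'_def[symmetric] z'_def[symmetric]
    by (simp add: P'_def V_def D_def t_Suc algebra_simps add_divide_distrib diff_divide_distrib)
  also have "\<dots> \<le> P + V * ((1 - q / 2) * comp_gap n F x (snap s))
      + c * (norm (lsvrg n F S x (snap s) - mean_op n F x))\<^sup>2"
    using 1 2 3 by linarith
  finally show ?thesis
    unfolding q_def s1_def s0_def P_def V_def c_def x_def .
qed

lemma lyapunov_step:
  "measure_pmf.expectation (vfosa_step n F T lam \<nu> t \<eta> (\<lambda>k. b) p k s) (lyapunov (Suc k)) \<le> lyapunov k s"
proof -
  define P where "P = potential \<nu> \<beta> (t k - \<mu>) (\<eta> k) xs (G (cur s)) (cur s) (aux s)"
  define gap where "gap = comp_gap n F (cur s) (snap s)"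
  define V where "V = W (Suc k) / real b * ((1 - p (Suc k) / 2) * gap)"
  define c where "c = 7 * \<beta> / (2 * \<mu>) * (t k * (t k - 1))"
  let ?err = "\<lambda>S. (norm (lsvrg n F S (cur s) (snap s) - mean_op n F (cur s)))\<^sup>2"
  let ?m = "real (card (batches n b))"
  have m: "?m > 0" using batches_nonempty[OF n, of b] batches_finite[of n b] by (simp add: card_gt_0_iff)
  have c: "c \<ge> 0" using \<beta> \<mu> t_gt[of k] by (simp add: c_def)
  have "0 < 3 / N" using N_ge(3) by simp
  then have p: "0 \<le> p (k + 1)" "p (k + 1) \<le> 1"
    using refresh_prob_bounds(1,2)[of "k + 1"] by linarith+
  have "measure_pmf.expectation (vfosa_step n F T lam \<nu> t \<eta> (\<lambda>k. b) p k s) (lyapunov (Suc k))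
      \<le> (\<Sum>S\<in>batches n b. P + V + c * ?err S) / ?m"
    unfolding expectation_vfosa_step[OF n, of p k, OF p]
    using lyapunov_step_batch[of k s]
    by (intro divide_right_mono sum_mono) (auto simp: P_def V_def c_def gap_def)
  also have "\<dots> = P + V + c * ((\<Sum>S\<in>batches n b. ?err S) / ?m)"
    using m by (simp add: sum.distrib sum_distrib_left[symmetric] add_divide_distrib)
  also have "\<dots> \<le> P + V + c * (gap / real b)"
    using lsvrg_variance[OF n batch_size_bounds(1), of F "cur s" "snap s"] c
    by (intro add_left_mono mult_left_mono) (auto simp: gap_def)
  also have "\<dots> = P + (W (Suc k) * (1 - p (Suc k) / 2) + c) * (gap / real b)"
  proof -
    have "V = W (Suc k) * (1 - p (Suc k) / 2) * (gap / real b)" by (simp add: V_def)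
    then show ?thesis unfolding distrib_right by (simp only: add.assoc)
  qed
  also have "\<dots> \<le> P + W k * (gap / real b)"
    using W_contraction[of k] unfolding c_def
    by (intro add_left_mono mult_right_mono) (auto simp: gap_def comp_gap_nonneg)
  finally show ?thesis by (simp add: lyapunov_def P_def gap_def)
qed

lemma X_Suc: "X (Suc k) = bind_pmf (X k) (vfosa_step n F T lam \<nu> t \<eta> (\<lambda>k. b) p k)"
  by (simp add: vfosa_lsvrg_def)

lemma X_finite: "finite (set_pmf (X k))"
  unfolding vfosa_lsvrg_def by (rule finite_set_pmf_vfosa[OF n])

lemma X_step_finite: "finite (set_pmf (vfosa_step n F T lam \<nu> t \<eta> (\<lambda>k. b) p k s))"
  by (simp add: vfosa_step_def Let_def batches_finite batches_nonempty[OF n])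

lemma expectation_X_Suc:
  fixes h :: "'a vstate \<Rightarrow> real"
  shows "measure_pmf.expectation (X (Suc k)) h = measure_pmf.expectation (X k)
     (\<lambda>s. measure_pmf.expectation (vfosa_step n F T lam \<nu> t \<eta> (\<lambda>k. b) p k s) h)"
  unfolding X_Suc by (rule expectation_bind_finite[OF X_finite X_step_finite])

text \<open>
  At time zero \<open>x\<close>, \<open>z\<close> and the snapshot coincide, so only the distance term and \<open>|G x\<^sup>0|\<^sup>2\<close> are left, and
  \<open>1 / (\<mu> \<eta>\<^sub>0)\<close> is \<open>\<beta>\<close> times the coefficient of \<open>|x\<^sup>0 - x\<^sup>\<star>|\<^sup>2\<close> in \<open>\<Psi>\<^sub>0\<^sup>2\<close>.
\<close>

lemma expectation_lyapunov_le:
  "measure_pmf.expectation (X k) (lyapunov k) \<le> \<beta> * (Psi0 n F T lam \<mu> \<beta> r x0 xs)\<^sup>2"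
proof (induction k)
  case 0
  have pos: "\<mu> * r > 1" "t 0 = \<mu> * r" using t_gt[of 0] by (auto simp: t_seq_def)
  define c where "c = (2 * r - 1) / (4 * \<beta>\<^sup>2 * (\<mu> * r - 1))"
  have "2 * r - 1 \<ge> 0" using r \<mu> by (smt (verit) divide_pos_pos)
  then have "c \<ge> 0" using pos \<beta> by (simp add: c_def)
  then have Psi: "(Psi0 n F T lam \<mu> \<beta> r x0 xs)\<^sup>2 = \<mu>\<^sup>2 * r\<^sup>2 * (norm (G x0))\<^sup>2 + c * (norm (x0 - xs))\<^sup>2"
    unfolding Psi0_def c_def[symmetric]
    by (intro real_sqrt_pow2 add_nonneg_nonneg mult_nonneg_nonneg) auto
  have c: "\<beta> * c = 1 / (\<mu> * \<eta> 0)"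
  proof -
    have "\<eta> 0 = 4 * \<beta> * (\<mu> * r - 1) / (\<mu> * (2 * r - 1))"
      using \<mu> by (simp add: eta_seq_def pos(2) field_simps)
    then show ?thesis using \<beta> \<mu> by (simp add: c_def power2_eq_square)
  qed
  have "\<beta> * (Psi0 n F T lam \<mu> \<beta> r x0 xs)\<^sup>2 = \<beta> * (\<mu> * r)\<^sup>2 * (norm (G x0))\<^sup>2 + \<beta> * c * (norm (x0 - xs))\<^sup>2"
    unfolding Psi by (simp only: distrib_left power_mult_distrib mult.assoc)
  then have "\<beta> * (Psi0 n F T lam \<mu> \<beta> r x0 xs)\<^sup>2 =
      \<beta> * (\<mu> * r)\<^sup>2 * (norm (G x0))\<^sup>2 + (norm (x0 - xs))\<^sup>2 / (\<mu> * \<eta> 0)"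
    unfolding c by simp
  moreover have "lyapunov 0 (VState x0 x0 x0 n 0) = \<beta> * ((\<mu> * r - \<mu>) * (\<mu> * r - \<mu> - 1)) * (norm (G x0))\<^sup>2
      + (norm (x0 - xs))\<^sup>2 / (\<mu> * \<eta> 0)"
    by (simp add: lyapunov_def potential_def comp_gap_def pos(2) mult.assoc)
  moreover have "\<beta> * ((\<mu> * r - \<mu>) * (\<mu> * r - \<mu> - 1)) * (norm (G x0))\<^sup>2 \<le> \<beta> * (\<mu> * r)\<^sup>2 * (norm (G x0))\<^sup>2"
    unfolding power2_eq_square[of "\<mu> * r"] using t_prev_gt[of 0] pos \<mu> \<beta>
    by (intro mult_right_mono mult_left_mono mult_mono) auto
  ultimately show ?case by (simp add: vfosa_lsvrg_def)
next
  case (Suc k)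
  have "measure_pmf.expectation (X (Suc k)) (lyapunov (Suc k)) \<le> measure_pmf.expectation (X k) (lyapunov k)"
    unfolding expectation_X_Suc
    by (intro integral_mono integrable_measure_pmf_finite X_finite lyapunov_step)
  then show ?case using Suc by linarith
qed

lemma expectation_residual_le:
  "(\<mu> * (real k + r - 1))\<^sup>2 * measure_pmf.expectation (X k) (\<lambda>s. (norm (G (cur s)))\<^sup>2)
    \<le> 2 * (Psi0 n F T lam \<mu> \<beta> r x0 xs)\<^sup>2"
proof -
  have t: "t k - \<mu> = \<mu> * (real k + r - 1)" by (simp add: t_seq_def algebra_simps)
  have "\<beta> / 2 * (\<mu> * (real k + r - 1))\<^sup>2 * (norm (G (cur s)))\<^sup>2 \<le> lyapunov k s" for s
  proof -
    have "\<beta> / 2 * (t k - \<mu>)\<^sup>2 * (norm (G (cur s)))\<^sup>2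
        \<le> potential \<nu> \<beta> (t k - \<mu>) (\<eta> k) xs (G (cur s)) (cur s) (aux s)"
      using t_prev_gt[of k] by (intro potential_ge[OF \<nu> \<beta> _ eta B(2) G_xs]) auto
    moreover have "W k / real b * comp_gap n F (cur s) (snap s) \<ge> 0"
      using W_nonneg[of k] comp_gap_nonneg[of n F "cur s" "snap s"] by simp
    ultimately show ?thesis unfolding lyapunov_def t by linarith
  qed
  then have "measure_pmf.expectation (X k) (\<lambda>s. \<beta> / 2 * (\<mu> * (real k + r - 1))\<^sup>2 * (norm (G (cur s)))\<^sup>2)
      \<le> measure_pmf.expectation (X k) (lyapunov k)"
    by (intro integral_mono integrable_measure_pmf_finite X_finite)
  also have "\<dots> \<le> \<beta> * (Psi0 n F T lam \<mu> \<beta> r x0 xs)\<^sup>2" by (rule expectation_lyapunov_le)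
  finally have "\<beta> * ((\<mu> * (real k + r - 1))\<^sup>2 * measure_pmf.expectation (X k) (\<lambda>s. (norm (G (cur s)))\<^sup>2))
      \<le> \<beta> * (2 * (Psi0 n F T lam \<mu> \<beta> r x0 xs)\<^sup>2)" by simp
  then show ?thesis using \<beta> by simp
qed

section \<open>Counting oracle calls\<close>

lemma refresh_prob_01: "0 \<le> p (k + 1)" "p (k + 1) \<le> 1"
proof -
  have "0 < 3 / N" using N_ge(3) by simp
  then show "0 \<le> p (k + 1)" "p (k + 1) \<le> 1"
    using refresh_prob_bounds(1,2)[of "k + 1"] by linarith+
qed

lemma expectation_F_calls:
  "measure_pmf.expectation (X K) (\<lambda>s. real (F_calls s)) = real n + (\<Sum>k<K. 2 * real b + real n * p (Suc k))"
proof (induction K)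
  case 0
  show ?case by (simp add: vfosa_lsvrg_def)
next
  case (Suc K)
  have "measure_pmf.expectation (vfosa_step n F T lam \<nu> t \<eta> (\<lambda>k. b) p K s) (\<lambda>s. real (F_calls s))
      = real (F_calls s) + (2 * real b + real n * p (Suc K))" for s
  proof -
    have "p (K + 1) * real (F_calls (next_state K s S True)) + (1 - p (K + 1)) * real (F_calls (next_state K s S False))
       = real (F_calls s) + (2 * real b + real n * p (Suc K))" for S
      by (simp add: vfosa_next_def Let_def algebra_simps)
    then show ?thesis
      unfolding expectation_vfosa_step[OF n, of p K, OF refresh_prob_01]
      using batches_nonempty[OF n, of b] batches_finite[of n b] by simp
  qed
  then have "measure_pmf.expectation (X (Suc K)) (\<lambda>s. real (F_calls s))
     = measure_pmf.expectation (X K) (\<lambda>s. real (F_calls s) + (2 * real b + real n * p (Suc K)))"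
    by (simp only: expectation_X_Suc)
  also have "\<dots> = measure_pmf.expectation (X K) (\<lambda>s. real (F_calls s)) + (2 * real b + real n * p (Suc K))"
    by (subst Bochner_Integration.integral_add) (auto intro: integrable_measure_pmf_finite X_finite)
  finally show ?case using Suc.IH by simp
qed

lemma expectation_J_calls:
  "measure_pmf.expectation (X K) (\<lambda>s. real (J_calls s)) = real K"
proof (induction K)
  case 0
  show ?case by (simp add: vfosa_lsvrg_def)
next
  case (Suc K)
  have "measure_pmf.expectation (vfosa_step n F T lam \<nu> t \<eta> (\<lambda>k. b) p K s) (\<lambda>s. real (J_calls s))
      = real (J_calls s) + 1" for s
  proof -
    have "p (K + 1) * real (J_calls (next_state K s S True)) + (1 - p (K + 1)) * real (J_calls (next_state K s S False))
       = real (J_calls s) + 1" for S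
      by (simp add: vfosa_next_def Let_def algebra_simps)
    then show ?thesis
      unfolding expectation_vfosa_step[OF n, of p K, OF refresh_prob_01]
      using batches_nonempty[OF n, of b] batches_finite[of n b] by simp
  qed
  then have "measure_pmf.expectation (X (Suc K)) (\<lambda>s. real (J_calls s))
     = measure_pmf.expectation (X K) (\<lambda>s. real (J_calls s) + 1)"
    by (simp only: expectation_X_Suc)
  also have "\<dots> = measure_pmf.expectation (X K) (\<lambda>s. real (J_calls s)) + 1"
    by (subst Bochner_Integration.integral_add) (auto intro: integrable_measure_pmf_finite X_finite)
  finally show ?case using Suc.IH by simp
qed

text \<open>
  Telescoping with \<open>1 / y \<le> ln y - ln (y - 1)\<close>; the truncation at \<open>4 N\<close> is where the first phase
  of the refresh probabilities ends.
\<close>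

lemma sum_inverse_le_ln:
  "(\<Sum>k<K. if real (Suc k) + a \<le> 4 * N then 1 / (real (Suc k) + a) else 0)
    \<le> ln (min (real K + a) (4 * N)) - ln a"
proof (induction K)
  case 0
  have "a \<le> 4 * N" using N_ge(2) by simp
  then show ?case by (simp add: min_def)
next
  case (Suc K)
  have pos: "real K + a > 0" "N > 0" using a(1) N_ge(3) by auto
  have "(if real (Suc K) + a \<le> 4 * N then 1 / (real (Suc K) + a) else 0)
      \<le> ln (min (real (Suc K) + a) (4 * N)) - ln (min (real K + a) (4 * N))"
  proof (cases "real (Suc K) + a \<le> 4 * N")
    case True
    have "ln ((real K + a) / (real (Suc K) + a)) \<le> (real K + a) / (real (Suc K) + a) - 1"
      using pos by (intro ln_le_minus_one) auto
    also have "\<dots> = - 1 / (real (Suc K) + a)"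
      using pos by (simp add: field_simps)
    finally have "1 / (real (Suc K) + a) \<le> ln (real (Suc K) + a) - ln (real K + a)"
      using pos by (simp add: ln_div)
    then show ?thesis using True by (simp add: min_def)
  next
    case False
    have "ln (min (real K + a) (4 * N)) \<le> ln (min (real (Suc K) + a) (4 * N))"
      using pos by (subst ln_le_cancel_iff) (auto simp: min_def)
    then show ?thesis using False by simp
  qed
  then show ?case using Suc.IH by simp
qed

lemma sum_refresh_prob_le: "(\<Sum>k<K. p (Suc k)) \<le> 3 * real K / N + 4 * ln (4 * N)"
proof -
  have "(\<Sum>k<K. p (Suc k)) \<le>
      (\<Sum>k<K. 3 / N + 4 * (if real (Suc k) + a \<le> 4 * N then 1 / (real (Suc k) + a) else 0))"
  proof (rule sum_mono)
    fix k
    show "p (Suc k) \<le> 3 / N + 4 * (if real (Suc k) + a \<le> 4 * N then 1 / (real (Suc k) + a) else 0)"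
      using refresh_prob_bounds(4)[of "Suc k"] by (simp split: if_splits)
  qed
  also have "\<dots> = 3 * real K / N + 4 * (\<Sum>k<K. if real (Suc k) + a \<le> 4 * N then 1 / (real (Suc k) + a) else 0)"
    by (simp add: sum.distrib sum_distrib_left)
  also have "\<dots> \<le> 3 * real K / N + 4 * (ln (min (real K + a) (4 * N)) - ln a)"
    using sum_inverse_le_ln[of K] by simp
  also have "\<dots> \<le> 3 * real K / N + 4 * ln (4 * N)"
  proof -
    have "ln (min (real K + a) (4 * N)) \<le> ln (4 * N)"
      using a(1) N_ge(3) by (subst ln_le_cancel_iff) auto
    moreover have "ln a \<ge> 0" using a(1) by simp
    ultimately show ?thesis by simp
  qed
  finally show ?thesis .
qed

text \<open>
  The offset \<open>r - 1 > 1\<close> in the rate keeps the rounded-up number of steps below \<open>\<surd>2 \<Psi>\<^sub>0 / (\<mu> \<epsilon>)\<close>.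
  The component count then stays \<open>8 n\<close> below the bound, so taking the floor of the bound does no harm. The
  resolvent count fits because \<open>c\<^sub>b n\<^sup>2\<^sup>\<omega> \<ge> 1\<close>.
\<close>

lemma solves_within_oracle_bound:
  assumes \<epsilon>: "\<epsilon> > 0"
  shows "solves_within X G \<epsilon>
     (real_of_int \<lfloor>real n + 4 * real n * (2 + ln (4 * c\<^sub>p * real n powr \<omega>))
        + sqrt 2 * Psi0 n F T lam \<mu> \<beta> r x0 xs / (\<mu> * \<epsilon>)
          * (2 * c_b L Lh \<mu> \<beta> c\<^sub>p * real n powr (2 * \<omega>) + 3 * real n powr (1 - \<omega>) / c\<^sub>p)\<rfloor>)"
    (is "solves_within X G \<epsilon> (real_of_int \<lfloor>?R\<rfloor>)")
proof -
  define \<Psi> where "\<Psi> = Psi0 n F T lam \<mu> \<beta> r x0 xs"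
  define A where "A = sqrt 2 * \<Psi> / (\<mu> * \<epsilon>)"
  define cbn where "cbn = c_b L Lh \<mu> \<beta> c\<^sub>p * real n powr (2 * \<omega>)"
  define K where "K = nat \<lceil>A - (r - 1)\<rceil>"
  have r5: "r > 5" using r \<mu> by (smt (verit) divide_pos_pos)
  have "\<Psi> \<ge> 0"
  proof -
    have "\<mu> * r > 1" using t_gt[of 0] by (simp add: t_seq_def)
    then show ?thesis unfolding \<Psi>_def Psi0_def using r5
      by (intro real_sqrt_ge_zero add_nonneg_nonneg mult_nonneg_nonneg divide_nonneg_nonneg) auto
  qed
  then have A: "A \<ge> 0" using \<mu> \<epsilon> by (simp add: A_def)
  have K_ge: "A \<le> real K + r - 1"
    using real_nat_ceiling_ge[of "A - (r - 1)"] by (simp add: K_def)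
  have K_le: "real K \<le> A"
  proof (cases "\<lceil>A - (r - 1)\<rceil> \<le> 0")
    case True
    then show ?thesis using A by (simp add: K_def)
  next
    case False
    then have "real K = of_int \<lceil>A - (r - 1)\<rceil>" by (simp add: K_def)
    then show ?thesis using ceiling_correct[of "A - (r - 1)"] r5 by linarith
  qed
  define E where "E = measure_pmf.expectation (X K) (\<lambda>s. (norm (G (cur s)))\<^sup>2)"
  have "E \<le> \<epsilon>\<^sup>2"
  proof -
    define m where "m = \<mu> * (real K + r - 1)"
    have m: "m > 0" using \<mu> r5 by (simp add: m_def)
    have "sqrt 2 * \<Psi> = \<mu> * A * \<epsilon>" using \<mu> \<epsilon> by (simp add: A_def)
    also have "\<dots> \<le> m * \<epsilon>" unfolding m_def using K_ge \<mu> \<epsilon> by (intro mult_right_mono mult_left_mono) auto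
    finally have "(sqrt 2 * \<Psi>)\<^sup>2 \<le> (m * \<epsilon>)\<^sup>2" using \<open>\<Psi> \<ge> 0\<close> by (intro power_mono) auto
    then have "m\<^sup>2 * E \<le> m\<^sup>2 * \<epsilon>\<^sup>2"
      using expectation_residual_le[of K] by (simp add: m_def E_def \<Psi>_def power_mult_distrib)
    then show ?thesis using m by simp
  qed
  moreover have "measure_pmf.expectation (X K) (\<lambda>s. real (F_calls s)) \<le> real_of_int \<lfloor>?R\<rfloor>"
  proof -
    have "measure_pmf.expectation (X K) (\<lambda>s. real (F_calls s))
        = real n + 2 * real b * real K + real n * (\<Sum>k<K. p (Suc k))"
      unfolding expectation_F_calls by (simp add: sum.distrib sum_distrib_left)
    also have "\<dots> \<le> real n + 2 * cbn * A + real n * (3 * real K / N + 4 * ln (4 * N))"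
      using batch_size_bounds(2) K_le A sum_refresh_prob_le[of K]
      by (intro add_mono mult_mono mult_left_mono order_refl) (auto simp: cbn_def)
    also have "\<dots> \<le> real n + 2 * cbn * A + (A * (3 * real n powr (1 - \<omega>) / c\<^sub>p) + 4 * real n * ln (4 * N))"
    proof -
      have "real n / N = real n powr (1 - \<omega>) / c\<^sub>p"
        using n by (simp add: N_def powr_diff)
      then have "real n * (3 * real K / N) = real K * (3 * real n powr (1 - \<omega>) / c\<^sub>p)"
        by (metis (no_types, lifting) mult.assoc mult.commute times_divide_eq_right)
      also have "\<dots> \<le> A * (3 * real n powr (1 - \<omega>) / c\<^sub>p)"
        using K_le cp by (intro mult_right_mono) auto
      finally show ?thesis by (simp add: ring_distribs)
    qed
    also have "\<dots> = ?R - 8 * real n"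
      by (simp add: A_def \<Psi>_def cbn_def N_def algebra_simps)
    also have "\<dots> \<le> ?R - 1" using n by simp
    finally show ?thesis by linarith
  qed
  moreover have "measure_pmf.expectation (X K) (\<lambda>s. real (J_calls s)) \<le> real_of_int \<lfloor>?R\<rfloor>"
  proof -
    have "1 \<le> 2 * cbn" using batch_size_bounds(1,2) by (simp add: cbn_def)
    then have "A * 1 \<le> A * (2 * cbn + 3 * real n powr (1 - \<omega>) / c\<^sub>p)"
      using A cp by (intro mult_left_mono add_increasing2) auto
    moreover have "ln (4 * N) \<ge> 0" using N_ge(3) by simp
    then have "real n + 4 * real n * (2 + ln (4 * N)) \<ge> 0" by simp
    ultimately have "A \<le> ?R" by (simp add: A_def \<Psi>_def cbn_def N_def mult.assoc)
    then have "int K \<le> \<lfloor>?R\<rfloor>" using K_le by (simp add: le_floor_iff)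
    then show ?thesis unfolding expectation_J_calls by linarith
  qed
  ultimately show ?thesis unfolding solves_within_def E_def by blast
qed

end

lemma solves_within_mono:
  "solves_within X G \<epsilon> N \<Longrightarrow> N \<le> N' \<Longrightarrow> solves_within X G \<epsilon> N'"
  unfolding solves_within_def by (meson order_trans)

text \<open>
  For \<open>\<omega> = 1 / 3\<close> both powers of \<open>n\<close> multiplying \<open>1 / \<epsilon>\<close> become \<open>n\<^sup>2\<^sup>/\<^sup>3\<close>, and \<open>n \<ge> 2\<close> lets
  \<open>n ln n\<close> absorb the terms linear in \<open>n\<close>.
\<close>

lemma oracle_bound_cube_root:
  fixes c\<^sub>p cb \<mu> \<epsilon> \<Psi> D :: real and n :: nat
  assumes n: "n \<ge> 2" and pos: "c\<^sub>p > 0" "cb \<ge> 0" "\<mu> > 0" "\<epsilon> > 0" and \<Psi>: "\<Psi> \<le> \<bar>D\<bar>"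
  shows "real n + 4 * real n * (2 + ln (4 * c\<^sub>p * real n powr (1 / 3)))
        + sqrt 2 * \<Psi> / (\<mu> * \<epsilon>) * (2 * cb * real n powr (2 * (1 / 3)) + 3 * real n powr (1 - 1 / 3) / c\<^sub>p)
    \<le> ((9 + 4 * \<bar>ln (4 * c\<^sub>p)\<bar>) / ln 2 + 4 / 3 + sqrt 2 * \<bar>D\<bar> / \<mu> * (2 * cb + 3 / c\<^sub>p))
       * (real n * ln (real n) + real n powr (2 / 3) / \<epsilon>)"
proof -
  define c1 where "c1 = (9 + 4 * \<bar>ln (4 * c\<^sub>p)\<bar>) / ln 2"
  define c2 where "c2 = sqrt 2 * \<bar>D\<bar> / \<mu> * (2 * cb + 3 / c\<^sub>p)"
  define U where "U = real n * ln (real n)"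
  define V where "V = real n powr (2 / 3) / \<epsilon>"
  have c: "c1 \<ge> 0" "c2 \<ge> 0" using pos by (simp_all add: c1_def c2_def)
  have ln: "ln (real n) \<ge> ln 2" using n by simp
  then have U: "U \<ge> 0" using n by (simp add: U_def)
  have V: "V \<ge> 0" using pos by (simp add: V_def)
  have "ln (4 * c\<^sub>p * real n powr (1 / 3)) = ln (4 * c\<^sub>p) + 1 / 3 * ln (real n)"
    using pos n by (simp add: ln_mult ln_powr)
  then have "real n + 4 * real n * (2 + ln (4 * c\<^sub>p * real n powr (1 / 3)))
      = real n * (9 + 4 * ln (4 * c\<^sub>p)) + 4 / 3 * U"
    by (simp add: U_def algebra_simps)
  also have "real n * (9 + 4 * ln (4 * c\<^sub>p)) \<le> real n * (c1 * ln 2)"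
    unfolding c1_def by (intro mult_left_mono) auto
  also have "\<dots> \<le> real n * (c1 * ln (real n))"
    using c ln by (intro mult_left_mono) auto
  finally have 1: "real n + 4 * real n * (2 + ln (4 * c\<^sub>p * real n powr (1 / 3))) \<le> (c1 + 4 / 3) * U"
    by (simp add: U_def algebra_simps)
  have "sqrt 2 * \<Psi> / (\<mu> * \<epsilon>) * (2 * cb * real n powr (2 * (1 / 3)) + 3 * real n powr (1 - 1 / 3) / c\<^sub>p)
      = \<Psi> * (sqrt 2 / \<mu> * (2 * cb + 3 / c\<^sub>p) * V)"
    by (simp add: V_def field_simps)
  also have "\<dots> \<le> \<bar>D\<bar> * (sqrt 2 / \<mu> * (2 * cb + 3 / c\<^sub>p) * V)"
    using \<Psi> pos V by (intro mult_right_mono) auto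
  also have "\<dots> = c2 * V" by (simp add: c2_def)
  finally have 2: "sqrt 2 * \<Psi> / (\<mu> * \<epsilon>) * (2 * cb * real n powr (2 * (1 / 3)) + 3 * real n powr (1 - 1 / 3) / c\<^sub>p) \<le> c2 * V" .
  have "(c1 + 4 / 3) * U + c2 * V \<le> (c1 + 4 / 3 + c2) * (U + V)"
    using c U V by (simp add: ring_distribs)
  then show ?thesis using 1 2 unfolding c1_def c2_def U_def V_def by linarith
qed

theorem corollary18:
  fixes \<rho> L Lh lam \<mu> \<beta> r c\<^sub>p cb :: real
  assumes "\<rho> \<ge> 0" and "L > 0" and "L * \<rho> < 1" and "Lh > L" and "Lh * \<rho> < 1"
    and "2 * \<rho> \<le> lam" and "lam < 2 * (1 + sqrt (1 - Lh * \<rho>)) / Lh"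
    and "0 < \<mu>" and "\<mu> < 2 / 3"
    and "0 < \<beta>" and "\<beta> \<le> (2 - \<mu>) * beta_bar \<rho> Lh lam / (2 + \<mu>)"
    and "r > 5 + 1 / \<mu>" and "c\<^sub>p > 0"
    and "cb = c_b L Lh \<mu> \<beta> c\<^sub>p"
  shows "(\<forall>n (F :: nat \<Rightarrow> real ^ 'p \<Rightarrow> real ^ 'p) T \<omega> x0 xs \<epsilon>.
           standing_assumptions n F T \<rho> L \<and> admissible_size \<mu> r c\<^sub>p cb n \<omega> \<and>
           x0 \<in> op_dom (sum_op (mean_op n F) T) \<and> xs \<in> zer (sum_op (mean_op n F) T) \<and> \<epsilon> > 0 \<longrightarrow>
           solves_within (vfosa_lsvrg n F T lam \<mu> \<beta> r c\<^sub>p cb \<omega> x0) (G_op lam n F T) \<epsilon>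
             (real_of_int \<lfloor>real n + 4 * real n * (2 + ln (4 * c\<^sub>p * real n powr \<omega>))
                + sqrt 2 * Psi0 n F T lam \<mu> \<beta> r x0 xs / (\<mu> * \<epsilon>)
                  * (2 * cb * real n powr (2 * \<omega>) + 3 * real n powr (1 - \<omega>) / c\<^sub>p)\<rfloor>)) \<and>
         (\<forall>D. \<exists>C. \<forall>n (F :: nat \<Rightarrow> real ^ 'p \<Rightarrow> real ^ 'p) T x0 xs \<epsilon>.
           n \<ge> 2 \<and> standing_assumptions n F T \<rho> L \<and> admissible_size \<mu> r c\<^sub>p cb n (1 / 3) \<and>
           x0 \<in> op_dom (sum_op (mean_op n F) T) \<and> xs \<in> zer (sum_op (mean_op n F) T) \<and>
           Psi0 n F T lam \<mu> \<beta> r x0 xs \<le> D \<and> \<epsilon> > 0 \<longrightarrow>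
           solves_within (vfosa_lsvrg n F T lam \<mu> \<beta> r c\<^sub>p cb (1 / 3) x0) (G_op lam n F T) \<epsilon>
             (C * (real n * ln (real n) + real n powr (2 / 3) / \<epsilon>)))"
proof -
  have bound: "solves_within (vfosa_lsvrg n F T lam \<mu> \<beta> r c\<^sub>p cb \<omega> x0) (G_op lam n F T) \<epsilon>
             (real_of_int \<lfloor>real n + 4 * real n * (2 + ln (4 * c\<^sub>p * real n powr \<omega>))
                + sqrt 2 * Psi0 n F T lam \<mu> \<beta> r x0 xs / (\<mu> * \<epsilon>)
                  * (2 * cb * real n powr (2 * \<omega>) + 3 * real n powr (1 - \<omega>) / c\<^sub>p)\<rfloor>)"
    if "standing_assumptions n F T \<rho> L" "admissible_size \<mu> r c\<^sub>p cb n \<omega>"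
      "xs \<in> zer (sum_op (mean_op n F) T)" "\<epsilon> > 0"
    for n and F :: "nat \<Rightarrow> real ^ 'p \<Rightarrow> real ^ 'p" and T \<omega> x0 xs \<epsilon>
  proof -
    interpret lsvrg_run n F T \<rho> L Lh lam \<mu> \<beta> r c\<^sub>p \<omega> x0 xs
      using assms that by unfold_locales auto
    show ?thesis unfolding \<open>cb = _\<close> by (rule solves_within_oracle_bound[OF that(4)])
  qed
  have "Lambda L Lh > 0" using assms by (simp add: Lambda_def)
  then have cb: "cb \<ge> 0" using assms by (simp add: c_b_def)
  have "solves_within (vfosa_lsvrg n F T lam \<mu> \<beta> r c\<^sub>p cb (1 / 3) x0) (G_op lam n F T) \<epsilon>
      (((9 + 4 * \<bar>ln (4 * c\<^sub>p)\<bar>) / ln 2 + 4 / 3 + sqrt 2 * \<bar>D\<bar> / \<mu> * (2 * cb + 3 / c\<^sub>p))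
       * (real n * ln (real n) + real n powr (2 / 3) / \<epsilon>))"
    if "n \<ge> 2" "standing_assumptions n F T \<rho> L" "admissible_size \<mu> r c\<^sub>p cb n (1 / 3)"
      "xs \<in> zer (sum_op (mean_op n F) T)" "Psi0 n F T lam \<mu> \<beta> r x0 xs \<le> D" "\<epsilon> > 0"
    for D n and F :: "nat \<Rightarrow> real ^ 'p \<Rightarrow> real ^ 'p" and T x0 xs \<epsilon>
  proof (rule solves_within_mono[OF bound[OF that(2,3,4,6)] order_trans[OF of_int_floor_le]])
    have "Psi0 n F T lam \<mu> \<beta> r x0 xs \<le> \<bar>D\<bar>" using that(5) by linarith
    with that(1) \<open>c\<^sub>p > 0\<close> cb \<open>0 < \<mu>\<close> that(6)
    show "real n + 4 * real n * (2 + ln (4 * c\<^sub>p * real n powr (1 / 3)))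
        + sqrt 2 * Psi0 n F T lam \<mu> \<beta> r x0 xs / (\<mu> * \<epsilon>)
          * (2 * cb * real n powr (2 * (1 / 3)) + 3 * real n powr (1 - 1 / 3) / c\<^sub>p)
      \<le> ((9 + 4 * \<bar>ln (4 * c\<^sub>p)\<bar>) / ln 2 + 4 / 3 + sqrt 2 * \<bar>D\<bar> / \<mu> * (2 * cb + 3 / c\<^sub>p))
       * (real n * ln (real n) + real n powr (2 / 3) / \<epsilon>)"
      by (rule oracle_bound_cube_root)
  qed
  then show ?thesis using bound by blast
qed

end
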